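(* Suppose that the stochastic kernel $J$ on $Y$ has the following property: for every $g\in C_b(Y\times\mathbb{R}_+)$, the map $Y\times\mathbb{R}_+\ni(y,t)\mapsto \int_Y g(u,t)\,J(y,du)$ is jointly continuous. (a) If $\mu_*^{\Phi}\in\mathcal{M}_1(X)$ is invariant for $P$, then $$\mu_*^{\Psi}:=\frac{\mu_*^{\Phi}\widetilde{G}}{\mu_*^{\Phi}\widetilde{G}(X)}$$ is an invariant probability measure of $\{P_t\}_{t\in\mathbb{R}_+}$, and $$\mu_*^{\Phi}=\frac{\mu_*^{\Psi}\widetilde{W}}{\mu_*^{\Psi}\widetilde{W}(X)}.$$ (b) If $\mu_*^{\Psi}\in\mathcal{M}_1(X)$ is invariant for $\{P_t\}_{t\in\mathbb{R}_+}$, then $$\mu_*^{\Phi}:=\frac{\mu_*^{\Psi}\widetilde{W}}{\mu_*^{\Psi}\widetilde{W}(X)}$$ is an invariant probability measure of $P$, and $\mu_*^{\Psi}$ can then be expressed as $$\mu_*^{\Psi}=\frac{\mu_*^{\Phi}\widetilde{G}}{\mu_*^{\Phi}\widetilde{G}(X)}.$$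
   Context: Notation. $\mathbb{R}_+=[0,\infty)$, $\mathbb{N}_0=\{0,1,2,\ldots\}$. For a metric space $E$: $\mathcal{B}(E)$ is the Borel $\sigma$-field, $B_b(E)$ the bounded Borel functions $E\to\mathbb{R}$, $C_b(E)$ the continuous ones among them, $\mathcal{M}_1(E)$ the Borel probability measures. A kernel on $E$ is a map $K:E\times\mathcal{B}(E)\to[0,\infty]$ that is Borel measurable in the first variable and a measure in the second; it is stochastic if $K(x,E)=1$ for all $x$. One writes $\mu K(A)=\int_E K(x,A)\,\mu(dx)$ and $Kf(x)=\int_E f(y)\,K(x,dy)$. A measure $\mu$ is invariant for $K$ if $\mu K=\mu$, and invariant for a family of kernels if it is invariant for each member. Model. $(Y,\rho_Y)$ is a non-empty complete separable metric space, $I$ is a non-empty finite set with the discrete topology, $X:=Y\times I$ and $\bar{X}:=X\times\mathbb{R}_+$ have the product topologies. $\{S_i: i\in I\}$ are jointly continuous semiflows $S_i:\mathbb{R}_+\times Y\to Y$, i.e. $S_i(s,S_i(t,y))=S_i(s+t,y)$ and $S_i(0,y)=y$. $\{\pi_{ij}: i,j\in I\}$ are continuous maps $Y\to[0,1]$ with $\sum_{j\in I}\pi_{ij}(y)=1$ for all $i\in I$, $y\in Y$. $\lambda:Y\to(0,\infty)$ is continuous with $\underline{\lambda}\le\lambda(y)\le\bar{\lambda}$ for all $y\in Y$, for constants $\underline{\lambda},\bar{\lambda}>0$. Put $\Lambda(y,i,t):=\int_0^t\lambda(S_i(h,y))\,dh$. $J:Y\times\mathcal{B}(Y)\to[0,1]$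 is a stochastic kernel. Define the stochastic kernel $\bar{P}$ on $\bar{X}$ by $$\bar{P}((y,i,s),\bar{A})=\int_0^\infty\lambda(S_i(t,y))e^{-\Lambda(y,i,t)}\int_Y\sum_{j\in I}\pi_{ij}(u)\mathbf{1}_{\bar{A}}(u,j,s+t)\,J(S_i(t,y),du)\,dt,$$ and the stochastic kernel $P$ on $X$ by $P((y,i),A):=\bar{P}((y,i,0),A\times\mathbb{R}_+)$. Process. For $\bar x\in\bar X$ let $\mathbb{P}_{\bar x}$ (expectation $\mathbb{E}_{\bar x}$) be the law under which $\bar{\Phi}=\{(Y_n,\xi_n,\tau_n)\}_{n\in\mathbb{N}_0}$ is the (canonical) time-homogeneous Markov chain on $\bar X$ with transition law $\bar P$ started at $\bar x$; then $\tau_n\uparrow\infty$ a.s., and $P$ is the transition law of $\Phi=\{(Y_n,\xi_n)\}_{n\in\mathbb{N}_0}$. The process $\Psi(t)=(Y(t),\xi(t))$ is defined by $Y(t)=S_{\xi_n}(t-\tau_n,Y_n)$, $\xi(t)=\xi_n$ for $t\in[\tau_n,\tau_{n+1})$, $n\in\mathbb{N}_0$. Its Markov transition semigroup is $\{P_t\}_{t\in\mathbb{R}_+}$, $P_t(x,A)=\mathbb{P}_{(x,0)}(\Psi(t)\in A)$ for $x\in X$, $A\in\mathcal{B}(X)$. Kernels $\widetilde G,\widetilde W$. For $x=(y,i)\in X$ and $A\in\mathcal{B}(X)$, $$\widetilde{G}(x,A)=\int_0^\infty e^{-\Lambda(y,i,t)}\mathbf{1}_A(S_i(t,y),i)\,dt,\qquad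 \widetilde{W}(x,A)=\lambda(y)\int_Y\sum_{j\in I}\pi_{ij}(u)\mathbf{1}_A(u,j)\,J(y,du).$$ (Equivalently, $\widetilde G(x,A)=G(\mathbf{1}_A/\hat\lambda)(x)$ and $\widetilde W(x,A)=\hat\lambda(x)W(x,A)$, where $\hat\lambda(y,i)=\lambda(y)$, $G(x,A)=\int_0^\infty\lambda(S_i(t,y))e^{-\Lambda(y,i,t)}\mathbf{1}_A(S_i(t,y),i)\,dt$ and $W(x,A)=\int_Y\sum_{j}\pi_{ij}(u)\mathbf{1}_A(u,j)J(y,du)$.) *)

theory Defs
  imports "HOL-Probability.Probability"
begin

text \<open>
  Finite index sets with the discrete topology. Second countability is derived, so that the
  Borel sigma-algebra of a product with such a type is the product sigma-algebra.
\<close>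

class finite_discrete = finite + discrete_topology

instance finite_discrete \<subseteq> second_countable_topology
proof
  have "open = generate_topology (UNIV :: 'a::finite_discrete set set)"
    by (intro ext) (simp add: discrete_topology_class.open_discrete generate_topology.Basis)
  then show "\<exists>B::'a::finite_discrete set set. countable B \<and> open = generate_topology B"
    by (intro exI[of _ UNIV]) (simp add: countable_finite)
qed


section \<open>Kernels\<close>

text \<open>
  A kernel on a Borel space is given by its measures \<open>K x\<close>; a stochastic kernel is an element of
  \<open>borel \<rightarrow>\<^sub>M prob_algebra borel\<close>, and the probability measures on a Borel space are the points
  of \<open>prob_algebra borel\<close>. The library's monadic bind is not used for \<open>\<mu>K\<close>, because it is only
  meaningful for subprobability kernels.
\<close>

definition kernel_app :: "'a measure \<Rightarrow> ('a \<Rightarrow> 'a measure) \<Rightarrow> 'a measure" where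
  "kernel_app \<mu> K = measure_of (space \<mu>) (sets \<mu>) (\<lambda>A. \<integral>\<^sup>+ x. emeasure (K x) A \<partial>\<mu>)"

definition invariant_for :: "'a measure \<Rightarrow> ('a \<Rightarrow> 'a measure) \<Rightarrow> bool" where
  "invariant_for \<mu> K \<longleftrightarrow> kernel_app \<mu> K = \<mu>"

definition normalized :: "'a measure \<Rightarrow> 'a measure" where
  "normalized \<mu> = scale_measure (1 / emeasure \<mu> (space \<mu>)) \<mu>"

text \<open>
  The canonical law on path space of the time-homogeneous Markov chain with state space \<open>M\<close>,
  transition kernel \<open>K\<close> and initial state \<open>x\<close>, as provided by the Ionescu-Tulcea theorem.
\<close>

definition chain_step :: "'a measure \<Rightarrow> ('a \<Rightarrow> 'a measure) \<Rightarrow> 'a \<Rightarrow> nat \<Rightarrow> (nat \<Rightarrow> 'a) \<Rightarrow> 'a measure" where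
  "chain_step M K x n \<omega> = (case n of 0 \<Rightarrow> return M x | Suc m \<Rightarrow> K (\<omega> m))"

definition chain_law :: "'a measure \<Rightarrow> ('a \<Rightarrow> 'a measure) \<Rightarrow> 'a \<Rightarrow> (nat \<Rightarrow> 'a) measure" where
  "chain_law M K x =
     projective_family.lim UNIV (Ionescu_Tulcea.CI (chain_step M K x) (\<lambda>_. M)) (\<lambda>_. M)"


section \<open>The model\<close>

text \<open>
  The time set is the half-line of nonnegative reals inside \<open>real\<close>; values of \<open>T\<close> at negative
  times are unconstrained and never used.
\<close>

definition semiflow :: "(real \<Rightarrow> 'y::topological_space \<Rightarrow> 'y) \<Rightarrow> bool" where
  "semiflow T \<longleftrightarrow>
     continuous_on ({0..} \<times> UNIV) (\<lambda>(t, y). T t y) \<and>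
     (\<forall>y. T 0 y = y) \<and>
     (\<forall>s\<ge>0. \<forall>t\<ge>0. \<forall>y. T s (T t y) = T (s + t) y)"

definition Lam :: "('i \<Rightarrow> real \<Rightarrow> 'y \<Rightarrow> 'y) \<Rightarrow> ('y \<Rightarrow> real) \<Rightarrow> 'y \<Rightarrow> 'i \<Rightarrow> real \<Rightarrow> real" where
  "Lam S lam y i t = (LBINT h:{0..t}. lam (S i h y))"

definition Xbar :: "('y::polish_space \<times> 'i::finite_discrete \<times> real) measure" where
  "Xbar = restrict_space borel {(y, i, s). 0 \<le> s}"

definition Pbar ::
  "('i \<Rightarrow> real \<Rightarrow> 'y \<Rightarrow> 'y) \<Rightarrow> ('i \<Rightarrow> 'i \<Rightarrow> 'y \<Rightarrow> real) \<Rightarrow> ('y \<Rightarrow> real) \<Rightarrow> ('y \<Rightarrow> 'y measure) \<Rightarrow>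
   'y::polish_space \<times> 'i::finite_discrete \<times> real \<Rightarrow> ('y \<times> 'i \<times> real) measure" where
  "Pbar S p lam J = (\<lambda>(y, i, s).
     measure_of (space Xbar) (sets Xbar) (\<lambda>A.
       \<integral>\<^sup>+ t\<in>{0..}.
         ennreal (lam (S i t y) * exp (- Lam S lam y i t)) *
         (\<integral>\<^sup>+ u. (\<Sum>j\<in>UNIV. ennreal (p i j u) * indicator A (u, j, s + t)) \<partial>J (S i t y))
       \<partial>lborel))"

text \<open>
  The preimage of \<open>A\<close> in the space of \<open>Xbar\<close> under the projection below is \<open>A \<times> [0,\<infinity>)\<close>.
\<close>

definition Pker ::
  "('i \<Rightarrow> real \<Rightarrow> 'y \<Rightarrow> 'y) \<Rightarrow> ('i \<Rightarrow> 'i \<Rightarrow> 'y \<Rightarrow> real) \<Rightarrow> ('y \<Rightarrow> real) \<Rightarrow> ('y \<Rightarrow> 'y measure) \<Rightarrow>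
   'y::polish_space \<times> 'i::finite_discrete \<Rightarrow> ('y \<times> 'i) measure" where
  "Pker S p lam J = (\<lambda>(y, i). distr (Pbar S p lam J (y, i, 0)) borel (\<lambda>(u, j, s). (u, j)))"

text \<open>
  A path is \<open>\<omega> n = (Y\<^sub>n, \<xi>\<^sub>n, \<tau>\<^sub>n)\<close>. For almost every path exactly one \<open>n\<close> satisfies
  \<open>\<tau>\<^sub>n \<le> t < \<tau>\<^sub>n\<^sub>+\<^sub>1\<close>; using the least one, and the initial state if there is none, only fixes
  measurable values on a null set.
\<close>

definition tau :: "(nat \<Rightarrow> 'y \<times> 'i \<times> real) \<Rightarrow> nat \<Rightarrow> real" where
  "tau \<omega> n = snd (snd (\<omega> n))"

definition Psi :: "('i \<Rightarrow> real \<Rightarrow> 'y \<Rightarrow> 'y) \<Rightarrow> real \<Rightarrow> (nat \<Rightarrow> 'y \<times> 'i \<times> real) \<Rightarrow> 'y \<times> 'i" where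
  "Psi S t \<omega> =
     (if \<exists>n. tau \<omega> n \<le> t \<and> t < tau \<omega> (Suc n)
      then (case \<omega> (LEAST n. tau \<omega> n \<le> t \<and> t < tau \<omega> (Suc n)) of (y, i, s) \<Rightarrow> (S i (t - s) y, i))
      else (case \<omega> 0 of (y, i, s) \<Rightarrow> (y, i)))"

definition Pt ::
  "('i \<Rightarrow> real \<Rightarrow> 'y \<Rightarrow> 'y) \<Rightarrow> ('i \<Rightarrow> 'i \<Rightarrow> 'y \<Rightarrow> real) \<Rightarrow> ('y \<Rightarrow> real) \<Rightarrow> ('y \<Rightarrow> 'y measure) \<Rightarrow>
   real \<Rightarrow> 'y::polish_space \<times> 'i::finite_discrete \<Rightarrow> ('y \<times> 'i) measure" where
  "Pt S p lam J t = (\<lambda>(y, i). distr (chain_law Xbar (Pbar S p lam J) (y, i, 0)) borel (Psi S t))"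

definition Gtilde ::
  "('i \<Rightarrow> real \<Rightarrow> 'y \<Rightarrow> 'y) \<Rightarrow> ('y \<Rightarrow> real) \<Rightarrow>
   'y::polish_space \<times> 'i::finite_discrete \<Rightarrow> ('y \<times> 'i) measure" where
  "Gtilde S lam = (\<lambda>(y, i).
     measure_of UNIV (sets borel) (\<lambda>A.
       \<integral>\<^sup>+ t\<in>{0..}. ennreal (exp (- Lam S lam y i t)) * indicator A (S i t y, i) \<partial>lborel))"

definition Wtilde ::
  "('i \<Rightarrow> 'i \<Rightarrow> 'y \<Rightarrow> real) \<Rightarrow> ('y \<Rightarrow> real) \<Rightarrow> ('y \<Rightarrow> 'y measure) \<Rightarrow>
   'y::polish_space \<times> 'i::finite_discrete \<Rightarrow> ('y \<times> 'i) measure" where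
  "Wtilde p lam J = (\<lambda>(y, i).
     measure_of UNIV (sets borel) (\<lambda>A.
       ennreal (lam y) *
       (\<integral>\<^sup>+ u. (\<Sum>j\<in>UNIV. ennreal (p i j u) * indicator A (u, j)) \<partial>J y)))"

end

theory Submission
  imports Defs
begin

text \<open>
Let \<open>Q\<^sub>t f x = exp (- \<Lambda>(x, t)) f (S\<^sub>t x)\<close> be the semigroup of the flow killed at its first jump (here
\<open>killed\<close>). Then \<open>Gtilde\<close> is the potential \<open>G = \<integral> Q\<^sub>t dt\<close> of this semigroup, \<open>Wtilde\<close> is the kernel
\<open>W\<close> of jumps weighted with their rate, and the chain of post-jump locations has the kernel
\<open>P = G W\<close>. The theorem rests on one equivalence (\<open>invariant_Pt_iff\<close>): a probability measure \<open>\<nu>\<close> is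
invariant for all \<open>P\<^sub>t\<close> if and only if \<open>\<nu> W G = \<nu>\<close>. Given this, the correspondence is algebra: if
\<open>\<mu> G W = \<mu>\<close>, then \<open>\<nu> = \<mu> G\<close> satisfies \<open>\<nu> W G = \<mu> G = \<nu>\<close> and \<open>\<nu> W = \<mu>\<close>; if \<open>\<nu> W G = \<nu>\<close>, then
\<open>\<mu> = \<nu> W\<close> satisfies \<open>\<mu> G W = \<mu>\<close> and \<open>\<mu> G = \<nu>\<close>. The bounds on the jump rate keep all masses in
\<open>(0, \<infinity>)\<close>, so that one can normalise.

For the equivalence, split \<open>P\<^sub>t\<close> according to the number of jumps up to time \<open>t\<close>. Given the \<open>n\<close>-th
post-jump location and time, the next jump is later than \<open>t\<close> with the probability that \<open>Q\<close> carries
as its weight, so (\<open>nn_integral_Pt\<close>)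
\<open>P\<^sub>t f (x) = \<Sum>\<^sub>n E\<^sub>x [Q\<^bsub>t - \<tau>\<^sub>n\<^esub> f (\<Phi>\<^sub>n)]\<close>, where \<open>Q\<^sub>s = 0\<close> for \<open>s < 0\<close>.
Conditioning the \<open>n + 1\<close>-st term on the time \<open>v\<close> of its last jump expresses it through the \<open>n\<close>-th one
(\<open>nn_integral_alive_Suc\<close>), and summation yields the renewal equation
\<open>\<nu> P\<^sub>t = \<nu> Q\<^sub>t + \<integral>\<^sub>0\<^sup>t \<nu> P\<^sub>v W Q\<^bsub>t - v\<^esub> dv\<close>.
If \<open>\<nu>\<close> is invariant, this reads \<open>\<nu> = \<nu> Q\<^sub>t + \<nu> W \<integral>\<^sub>0\<^sup>t Q\<^sub>u du\<close>, and \<open>t \<rightarrow> \<infinity>\<close> gives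
\<open>\<nu> = \<nu> W G\<close> (\<open>jump_balance_if_invariant\<close>). Conversely, if \<open>\<nu> = \<kappa> G\<close> with \<open>\<kappa> = \<nu> W\<close>, then
\<open>\<kappa> G Q\<^sub>t + \<kappa> \<integral>\<^sub>0\<^sup>t Q\<^sub>u du = \<kappa> G\<close> shows that the constant \<open>\<nu>\<close> solves the same equation. As
\<open>\<nu> P\<^sub>t\<close> is the sum of its Picard iterates, it is dominated by every nonnegative solution, so
\<open>\<nu> P\<^sub>t \<le> \<nu>\<close>; both have mass one, hence they agree (\<open>invariant_if_jump_balance\<close>).

All functions are nonnegative with values in \<open>[0, \<infinity>]\<close>, so Tonelli applies throughout; functions of
time are extended by \<open>0\<close> to negative times, so that convolutions become integrals over the whole
line and only translations and reflections are needed to rearrange them.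
\<close>


section \<open>Measures given by functionals on nonnegative functions\<close>

text \<open>
These are the functionals of the form \<open>f \<mapsto> \<integral> f d\<mu>\<close>. The kernels of the model are given by set
functions \<open>A \<mapsto> \<Phi> (indicator A)\<close>; checking the four conditions on \<open>\<Phi>\<close> shows at once that such a set
function is a measure and that its integral is \<open>\<Phi>\<close>. The conditions are stable under composition
(\<open>nn_functional_subst\<close>), which covers all kernels below.
\<close>

definition nn_functional :: "'a measure \<Rightarrow> (('a \<Rightarrow> ennreal) \<Rightarrow> ennreal) \<Rightarrow> bool" where
  "nn_functional M \<Phi> \<longleftrightarrow>
     (\<forall>f\<in>borel_measurable M. \<forall>g\<in>borel_measurable M. \<Phi> (\<lambda>x. f x + g x) = \<Phi> f + \<Phi> g) \<and>
     (\<forall>c. \<forall>f\<in>borel_measurable M. \<Phi> (\<lambda>x. c * f x) = c * \<Phi> f) \<and>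
     (\<forall>F. (\<forall>n::nat. F n \<in> borel_measurable M) \<longrightarrow> incseq F \<longrightarrow>
        \<Phi> (\<lambda>x. SUP n. F n x) = (SUP n. \<Phi> (F n))) \<and>
     (\<forall>f g. (\<forall>x\<in>space M. f x = g x) \<longrightarrow> \<Phi> f = \<Phi> g)"

lemma nn_functionalD:
  assumes "nn_functional M \<Phi>"
  shows nn_functional_add: "f \<in> borel_measurable M \<Longrightarrow> g \<in> borel_measurable M \<Longrightarrow>
      \<Phi> (\<lambda>x. f x + g x) = \<Phi> f + \<Phi> g"
    and nn_functional_cmult: "f \<in> borel_measurable M \<Longrightarrow> \<Phi> (\<lambda>x. c * f x) = c * \<Phi> f"
    and nn_functional_SUP: "(\<And>n::nat. F n \<in> borel_measurable M) \<Longrightarrow> incseq F \<Longrightarrow>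
      \<Phi> (\<lambda>x. SUP n. F n x) = (SUP n. \<Phi> (F n))"
    and nn_functional_cong: "(\<And>x. x \<in> space M \<Longrightarrow> f x = g x) \<Longrightarrow> \<Phi> f = \<Phi> g"
  using assms unfolding nn_functional_def by metis+

lemma nn_functional_zero: "nn_functional M \<Phi> \<Longrightarrow> \<Phi> (\<lambda>x. 0) = 0"
  using nn_functional_cmult[of M \<Phi> "\<lambda>x. 0" 0] by simp

lemma nn_functional_mono:
  assumes \<Phi>: "nn_functional M \<Phi>" and [measurable]: "f \<in> borel_measurable M" "g \<in> borel_measurable M"
    and le: "\<And>x. x \<in> space M \<Longrightarrow> f x \<le> g x"
  shows "\<Phi> f \<le> \<Phi> g"
proof -
  have "\<Phi> g = \<Phi> (\<lambda>x. f x + (g x - f x))"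
    by (intro nn_functional_cong[OF \<Phi>]) (metis le diff_add_cancel_ennreal add.commute)
  also have "\<dots> = \<Phi> f + \<Phi> (\<lambda>x. g x - f x)"
    by (intro nn_functional_add[OF \<Phi>]) auto
  finally show ?thesis by simp
qed

lemma nn_functional_suminf:
  assumes \<Phi>: "nn_functional M \<Phi>" and F[measurable]: "\<And>n::nat. F n \<in> borel_measurable M"
  shows "\<Phi> (\<lambda>x. \<Sum>n. F n x) = (\<Sum>n. \<Phi> (F n))"
proof -
  have fin: "\<Phi> (\<lambda>x. \<Sum>i<n. F i x) = (\<Sum>i<n. \<Phi> (F i))" for n
  proof (induction n)
    case (Suc n)
    then show ?case using nn_functional_add[OF \<Phi>, of "\<lambda>x. \<Sum>i<n. F i x" "F n"] by simp
  qed (simp add: nn_functional_zero[OF \<Phi>])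
  have "\<Phi> (\<lambda>x. \<Sum>n. F n x) = \<Phi> (\<lambda>x. SUP n. \<Sum>i<n. F i x)"
    by (simp add: suminf_eq_SUP)
  also have "\<dots> = (SUP n. \<Phi> (\<lambda>x. \<Sum>i<n. F i x))"
    by (intro nn_functional_SUP[OF \<Phi>])
       (auto simp: incseq_def le_fun_def intro!: sum_mono2)
  finally show ?thesis by (simp add: fin suminf_eq_SUP)
qed

text \<open>
Countable additivity is \<open>nn_functional_suminf\<close> for indicators; the formula for the integral then
spreads from indicators to all nonnegative measurable functions by monotone approximation.
\<close>

lemma
  assumes \<Phi>: "nn_functional M \<Phi>"
    and N: "N = measure_of (space M) (sets M) (\<lambda>A. \<Phi> (indicator A))"
  shows sets_nn_functional: "sets N = sets M"
    and emeasure_nn_functional: "A \<in> sets M \<Longrightarrow> emeasure N A = \<Phi> (indicator A)"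
    and nn_integral_nn_functional: "f \<in> borel_measurable M \<Longrightarrow> (\<integral>\<^sup>+x. f x \<partial>N) = \<Phi> f"
proof -
  show sets: "sets N = sets M" unfolding N by simp
  have space: "space N = space M" using sets by (rule sets_eq_imp_space_eq)
  have em: "emeasure N A = \<Phi> (indicator A)" if "A \<in> sets M" for A
    unfolding N
  proof (rule emeasure_measure_of_sigma)
    show "sigma_algebra (space M) (sets M)" ..
    show "positive (sets M) (\<lambda>A. \<Phi> (indicator A))"
      using nn_functional_zero[OF \<Phi>] by (simp add: positive_def indicator_def[abs_def])
    show "countably_additive (sets M) (\<lambda>A. \<Phi> (indicator A))"
    proof (rule countably_additiveI)
      fix A :: "nat \<Rightarrow> _" assume A: "range A \<subseteq> sets M" "disjoint_family A"
      have "(\<Sum>i. \<Phi> (indicator (A i))) = \<Phi> (\<lambda>x. \<Sum>i. indicator (A i) x)"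
        by (rule nn_functional_suminf[OF \<Phi>, symmetric]) (use A in auto)
      also have "(\<lambda>x. \<Sum>i. indicator (A i) x) = (indicator (\<Union>i. A i) :: _ \<Rightarrow> ennreal)"
        by (simp add: suminf_indicator[OF A(2)])
      finally show "(\<Sum>i. \<Phi> (indicator (A i))) = \<Phi> (indicator (\<Union>i. A i))" .
    qed
  qed fact
  then show "A \<in> sets M \<Longrightarrow> emeasure N A = \<Phi> (indicator A)" by simp
  show "(\<integral>\<^sup>+x. f x \<partial>N) = \<Phi> f" if "f \<in> borel_measurable M"
    using that
  proof (induction rule: borel_measurable_induct)
    case (cong f g)
    then show ?case
      using nn_functional_cong[OF \<Phi>, of f g] nn_integral_cong[of N f g] by (simp add: space)
  next
    case (set A)
    then show ?case using em sets by simp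
  next
    case (mult u c)
    then show ?case
      using nn_functional_cmult[OF \<Phi>, of u c] measurable_cong_sets[OF sets refl, of "borel :: ennreal measure"]
      by (simp add: nn_integral_cmult)
  next
    case (add u v)
    then show ?case
      using nn_functional_add[OF \<Phi>, of v u] measurable_cong_sets[OF sets refl, of "borel :: ennreal measure"]
      by (simp add: nn_integral_add)
  next
    case (seq U)
    have "(\<integral>\<^sup>+x. (SUP i. U i x) \<partial>N) = (SUP i. \<integral>\<^sup>+x. U i x \<partial>N)"
      using seq measurable_cong_sets[OF sets refl, of "borel :: ennreal measure"]
      by (intro nn_integral_monotone_convergence_SUP) auto
    then show ?case
      using seq nn_functional_SUP[OF \<Phi>, of U] by (simp add: image_comp SUP_apply[abs_def])
  qed
qed

lemma nn_functional_eval: "a \<in> space M \<Longrightarrow> nn_functional M (\<lambda>f. f a)"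
  by (auto simp: nn_functional_def)

lemma nn_functional_integral:
  assumes sets: "sets N = sets M"
  shows "nn_functional M (\<lambda>f. \<integral>\<^sup>+x. f x \<partial>N)"
  unfolding nn_functional_def
  using measurable_cong_sets[OF sets refl, of "borel :: ennreal measure"]
    sets_eq_imp_space_eq[OF sets]
  by (auto simp: nn_integral_add nn_integral_cmult nn_integral_monotone_convergence_SUP
      intro!: nn_integral_cong)

lemma nn_functional_subst:
  assumes \<Psi>: "nn_functional N \<Psi>"
    and \<Phi>: "\<And>w. w \<in> space N \<Longrightarrow> nn_functional M (\<Phi> w)"
    and [measurable]: "\<And>f. f \<in> borel_measurable M \<Longrightarrow> (\<lambda>w. \<Phi> w f) \<in> borel_measurable N"
  shows "nn_functional (M :: 'b measure) (\<lambda>f. \<Psi> (\<lambda>w. \<Phi> w f))"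
  unfolding nn_functional_def
proof (intro conjI ballI allI impI)
  fix f g :: "'b \<Rightarrow> ennreal"
  assume [measurable]: "f \<in> borel_measurable M" "g \<in> borel_measurable M"
  have "\<Psi> (\<lambda>w. \<Phi> w (\<lambda>x. f x + g x)) = \<Psi> (\<lambda>w. \<Phi> w f + \<Phi> w g)"
    by (intro nn_functional_cong[OF \<Psi>]) (simp add: nn_functional_add[OF \<Phi>])
  then show "\<Psi> (\<lambda>w. \<Phi> w (\<lambda>x. f x + g x)) = \<Psi> (\<lambda>w. \<Phi> w f) + \<Psi> (\<lambda>w. \<Phi> w g)"
    by (simp add: nn_functional_add[OF \<Psi>])
next
  fix c and f :: "'b \<Rightarrow> ennreal" assume [measurable]: "f \<in> borel_measurable M"
  have "\<Psi> (\<lambda>w. \<Phi> w (\<lambda>x. c * f x)) = \<Psi> (\<lambda>w. c * \<Phi> w f)"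
    by (intro nn_functional_cong[OF \<Psi>]) (simp add: nn_functional_cmult[OF \<Phi>])
  then show "\<Psi> (\<lambda>w. \<Phi> w (\<lambda>x. c * f x)) = c * \<Psi> (\<lambda>w. \<Phi> w f)"
    by (simp add: nn_functional_cmult[OF \<Psi>])
next
  fix F :: "nat \<Rightarrow> 'b \<Rightarrow> ennreal" assume [rule_format, measurable]: "\<forall>n. F n \<in> borel_measurable M"
    and inc: "incseq F"
  have mono: "\<Phi> w (F m) \<le> \<Phi> w (F n)" if "w \<in> space N" "m \<le> n" for w m n
    using that inc by (intro nn_functional_mono[OF \<Phi>]) (auto simp: incseq_def le_fun_def)
  \<comment> \<open>Monotonicity in \<open>n\<close> is only known on the space of \<open>N\<close>, but \<open>incseq\<close> speaks of all points.\<close>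
  define G where "G n w = (if w \<in> space N then \<Phi> w (F n) else 0)" for n w
  have G: "\<Psi> (\<lambda>w. \<Phi> w (F n)) = \<Psi> (G n)" for n
    by (intro nn_functional_cong[OF \<Psi>]) (simp add: G_def)
  have "\<Psi> (\<lambda>w. \<Phi> w (\<lambda>x. SUP n. F n x)) = \<Psi> (\<lambda>w. SUP n. G n w)"
    using inc by (intro nn_functional_cong[OF \<Psi>]) (simp add: G_def nn_functional_SUP[OF \<Phi>])
  also have "\<dots> = (SUP n. \<Psi> (G n))"
    by (intro nn_functional_SUP[OF \<Psi>])
       (auto simp: G_def[abs_def] incseq_def le_fun_def mono cong: measurable_cong)
  finally show "\<Psi> (\<lambda>w. \<Phi> w (\<lambda>x. SUP n. F n x)) = (SUP n. \<Psi> (\<lambda>w. \<Phi> w (F n)))"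
    by (simp add: G)
next
  fix f g :: "'b \<Rightarrow> ennreal" assume "\<forall>x\<in>space M. f x = g x"
  then show "\<Psi> (\<lambda>w. \<Phi> w f) = \<Psi> (\<lambda>w. \<Phi> w g)"
    by (intro nn_functional_cong[OF \<Psi>] nn_functional_cong[OF \<Phi>]) auto
qed

lemma nn_functional_scale:
  assumes \<Phi>: "nn_functional M \<Phi>"
  shows "nn_functional M (\<lambda>f. c * \<Phi> f)"
  unfolding nn_functional_def
proof (intro conjI ballI allI impI)
  fix f g :: "'a \<Rightarrow> ennreal" assume "\<forall>x\<in>space M. f x = g x"
  then show "c * \<Phi> f = c * \<Phi> g" using nn_functional_cong[OF \<Phi>, of f g] by simp
qed (auto simp: nn_functional_add[OF \<Phi>] nn_functional_cmult[OF \<Phi>] nn_functional_SUP[OF \<Phi>]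
   distrib_left mult.left_commute SUP_mult_left_ennreal)

lemma nn_functional_sum:
  assumes \<Phi>: "\<And>j. j \<in> I \<Longrightarrow> nn_functional M (\<Phi> j)"
  shows "nn_functional M (\<lambda>f. \<Sum>j\<in>I. \<Phi> j f)"
proof (cases "finite I")
  case True
  then show ?thesis
    using nn_functional_subst[OF nn_functional_integral[OF refl], of "count_space I" M \<Phi>] \<Phi>
    by (simp add: nn_integral_count_space_finite)
qed (auto simp: nn_functional_def)

lemma borel_measurable_kernel_integral:
  assumes "\<And>A. A \<in> sets M \<Longrightarrow> (\<lambda>x. emeasure (K x) A) \<in> borel_measurable \<mu>"
    and "\<And>x. x \<in> space \<mu> \<Longrightarrow> sets (K x) = sets M"
  shows "f \<in> borel_measurable M \<Longrightarrow> (\<lambda>x. \<integral>\<^sup>+y. f y \<partial>K x) \<in> borel_measurable \<mu>"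
proof (induction rule: borel_measurable_induct)
  case (cong f g)
  then have "(\<integral>\<^sup>+y. f y \<partial>K x) = (\<integral>\<^sup>+y. g y \<partial>K x)" if "x \<in> space \<mu>" for x
    using that assms(2)[THEN sets_eq_imp_space_eq] by (intro nn_integral_cong) auto
  with cong show ?case by (simp cong: measurable_cong)
next
  case (set A)
  then show ?case using assms by (simp cong: measurable_cong)
next
  case (mult u c)
  then have "(\<integral>\<^sup>+y. c * u y \<partial>K x) = c * (\<integral>\<^sup>+y. u y \<partial>K x)" if "x \<in> space \<mu>" for x
    using that measurable_cong_sets[OF assms(2) refl, of _ "borel :: ennreal measure"] by (intro nn_integral_cmult) auto
  with mult show ?case by (simp cong: measurable_cong)
next
  case (add u v)
  then have "(\<integral>\<^sup>+y. v y + u y \<partial>K x) = (\<integral>\<^sup>+y. v y \<partial>K x) + (\<integral>\<^sup>+y. u y \<partial>K x)" if "x \<in> space \<mu>" for x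
    using that measurable_cong_sets[OF assms(2) refl, of _ "borel :: ennreal measure"] by (intro nn_integral_add) auto
  with add show ?case by (simp cong: measurable_cong)
next
  case (seq U)
  then have "(\<integral>\<^sup>+y. (SUP i. U i y) \<partial>K x) = (SUP i. \<integral>\<^sup>+y. U i y \<partial>K x)" if "x \<in> space \<mu>" for x
    using that measurable_cong_sets[OF assms(2) refl, of _ "borel :: ennreal measure"] by (intro nn_integral_monotone_convergence_SUP) auto
  with seq show ?case by (simp add: SUP_apply[abs_def] image_comp cong: measurable_cong)
qed

lemma nn_integral_kernel_app:
  assumes em: "\<And>A. A \<in> sets \<mu> \<Longrightarrow> (\<lambda>x. emeasure (K x) A) \<in> borel_measurable \<mu>"
    and sets: "\<And>x. x \<in> space \<mu> \<Longrightarrow> sets (K x) = sets \<mu>"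
  shows "f \<in> borel_measurable \<mu> \<Longrightarrow>
      (\<integral>\<^sup>+y. f y \<partial>kernel_app \<mu> K) = (\<integral>\<^sup>+x. \<integral>\<^sup>+y. f y \<partial>K x \<partial>\<mu>)"
proof -
  have \<Phi>: "nn_functional \<mu> (\<lambda>f. \<integral>\<^sup>+x. \<integral>\<^sup>+y. f y \<partial>K x \<partial>\<mu>)"
    using sets borel_measurable_kernel_integral[OF em sets]
    by (intro nn_functional_subst[OF nn_functional_integral] nn_functional_integral) auto
  have "kernel_app \<mu> K = measure_of (space \<mu>) (sets \<mu>)
     (\<lambda>A. (\<integral>\<^sup>+x. \<integral>\<^sup>+y. indicator A y \<partial>K x \<partial>\<mu>))"
    unfolding kernel_app_def
    by (intro measure_of_eq) (auto simp: sets.space_closed sets.sigma_sets_eq sets intro!: nn_integral_cong)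
  from nn_integral_nn_functional[OF \<Phi> this]
  show "f \<in> borel_measurable \<mu> \<Longrightarrow>
      (\<integral>\<^sup>+y. f y \<partial>kernel_app \<mu> K) = (\<integral>\<^sup>+x. \<integral>\<^sup>+y. f y \<partial>K x \<partial>\<mu>)" .
qed

lemma sets_kernel_app[simp, measurable_cong]: "sets (kernel_app \<mu> K) = sets \<mu>"
  by (simp add: kernel_app_def)

lemma space_kernel_app[simp]: "space (kernel_app \<mu> K) = space \<mu>"
  by (simp add: kernel_app_def)

lemma measure_eqI_nn_integral:
  assumes sets: "sets M = sets N"
    and eq: "\<And>f. f \<in> borel_measurable M \<Longrightarrow> (\<integral>\<^sup>+x. f x \<partial>M) = (\<integral>\<^sup>+x. f x \<partial>N)"
  shows "M = N"
proof (rule measure_eqI[OF sets])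
  fix A assume "A \<in> sets M"
  then show "emeasure M A = emeasure N A"
    using eq[of "indicator A"] sets by simp
qed

text \<open>
The action of a kernel on measures is dual to its action \<open>\<Phi>\<close> on functions. Stating this for an
arbitrary formula \<open>\<Phi>\<close> for the integrals leaves only the measurability of that formula to be checked.
\<close>

lemma nn_integral_kernel_app_eq:
  assumes sets: "sets \<mu> = sets M"
    and K: "\<And>x. x \<in> space M \<Longrightarrow> sets (K x) = sets M"
    and \<Phi>: "\<And>x f. x \<in> space M \<Longrightarrow> f \<in> borel_measurable M \<Longrightarrow> (\<integral>\<^sup>+y. f y \<partial>K x) = \<Phi> f x"
    and \<Phi>_meas: "\<And>f. f \<in> borel_measurable M \<Longrightarrow> \<Phi> f \<in> borel_measurable M"
    and f: "f \<in> borel_measurable M"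
  shows "(\<integral>\<^sup>+y. f y \<partial>kernel_app \<mu> K) = (\<integral>\<^sup>+x. \<Phi> f x \<partial>\<mu>)"
proof -
  have space: "space \<mu> = space M" using sets by (rule sets_eq_imp_space_eq)
  have "(\<integral>\<^sup>+y. f y \<partial>kernel_app \<mu> K) = (\<integral>\<^sup>+x. \<integral>\<^sup>+y. f y \<partial>K x \<partial>\<mu>)"
  proof (rule nn_integral_kernel_app)
    fix A assume A: "A \<in> sets \<mu>"
    have "emeasure (K x) A = \<Phi> (indicator A) x" if "x \<in> space \<mu>" for x
      using \<Phi>[of x "indicator A"] that A K[of x] by (simp add: sets space)
    moreover have "\<Phi> (indicator A) \<in> borel_measurable \<mu>"
      using \<Phi>_meas[of "indicator A"] A by (subst measurable_cong_sets[OF sets refl]) (simp add: sets)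
    ultimately show "(\<lambda>x. emeasure (K x) A) \<in> borel_measurable \<mu>"
      by (simp cong: measurable_cong)
  qed (use K f sets space in \<open>auto simp: measurable_cong_sets[OF sets refl, of "borel :: ennreal measure"]\<close>)
  also have "\<dots> = (\<integral>\<^sup>+x. \<Phi> f x \<partial>\<mu>)"
    using \<Phi>[OF _ f] by (intro nn_integral_cong) (simp add: space)
  finally show ?thesis .
qed

lemma kernel_app_scale:
  assumes sets: "sets \<mu> = sets M"
    and K: "\<And>x. x \<in> space M \<Longrightarrow> sets (K x) = sets M"
    and \<Phi>: "\<And>x f. x \<in> space M \<Longrightarrow> f \<in> borel_measurable M \<Longrightarrow> (\<integral>\<^sup>+y. f y \<partial>K x) = \<Phi> f x"
    and \<Phi>_meas: "\<And>f. f \<in> borel_measurable M \<Longrightarrow> \<Phi> f \<in> borel_measurable M"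
  shows "kernel_app (scale_measure c \<mu>) K = scale_measure c (kernel_app \<mu> K)"
proof (rule measure_eqI_nn_integral)
  fix f :: "'a \<Rightarrow> ennreal" assume "f \<in> borel_measurable (kernel_app (scale_measure c \<mu>) K)"
  then have f: "f \<in> borel_measurable M"
    using measurable_cong_sets[OF sets refl, of "borel :: ennreal measure"] by (simp cong: measurable_cong_sets)
  have f': "f \<in> borel_measurable (kernel_app \<mu> K)" and \<Phi>f: "\<Phi> f \<in> borel_measurable \<mu>"
    using f \<Phi>_meas[OF f] measurable_cong_sets[OF sets refl, of "borel :: ennreal measure"]
    by (simp_all cong: measurable_cong_sets)
  have "(\<integral>\<^sup>+y. f y \<partial>kernel_app (scale_measure c \<mu>) K) = (\<integral>\<^sup>+x. \<Phi> f x \<partial>scale_measure c \<mu>)"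
    by (rule nn_integral_kernel_app_eq[OF _ K \<Phi> \<Phi>_meas f]) (simp_all add: sets)
  also have "\<dots> = c * (\<integral>\<^sup>+y. f y \<partial>kernel_app \<mu> K)"
    by (simp add: nn_integral_scale_measure[OF \<Phi>f] nn_integral_kernel_app_eq[OF sets K \<Phi> \<Phi>_meas f])
  finally show "(\<integral>\<^sup>+y. f y \<partial>kernel_app (scale_measure c \<mu>) K) = (\<integral>\<^sup>+y. f y \<partial>scale_measure c (kernel_app \<mu> K))"
    by (simp add: nn_integral_scale_measure[OF f'])
qed simp

lemma emeasure_space_nn_integral: "emeasure \<mu> (space \<mu>) = (\<integral>\<^sup>+x. 1 \<partial>\<mu>)"
  by simp

lemma normalized_in_prob_algebra:
  assumes "sets \<mu> = sets M" "0 < emeasure \<mu> (space \<mu>)" "emeasure \<mu> (space \<mu>) < \<infinity>"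
  shows "normalized \<mu> \<in> space (prob_algebra M)"
  using assms
  by (auto simp: normalized_def space_prob_algebra space_scale_measure ennreal_divide_times
      ennreal_divide_self intro!: prob_spaceI)

lemma normalized_scale_prob_space:
  assumes "prob_space \<mu>" "0 < c" "c < \<infinity>"
  shows "normalized (scale_measure c \<mu>) = \<mu>"
  using prob_space.emeasure_space_1[OF assms(1)] assms(2,3)
  by (simp add: normalized_def space_scale_measure ennreal_divide_times ennreal_divide_self)

section \<open>The canonical Markov chain\<close>

context
  fixes M :: "'a measure" and K :: "'a \<Rightarrow> 'a measure" and x :: 'a
  assumes K: "K \<in> M \<rightarrow>\<^sub>M prob_algebra M" and x: "x \<in> space M"
begin

interpretation IT: Ionescu_Tulcea "chain_step M K x" "\<lambda>_. M"
proof (rule Ionescu_Tulcea.intro)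
  note measurable_prob_algebraD[OF K, measurable]
  show "chain_step M K x i \<in> Pi\<^sub>M {0..<i} (\<lambda>_. M) \<rightarrow>\<^sub>M subprob_algebra M" for i
    using x by (cases i) (auto simp: chain_step_def[abs_def] intro!: measurable_const return_measurable[THEN measurable_space])
  show "prob_space (chain_step M K x i \<omega>)" if "\<omega> \<in> space (Pi\<^sub>M {0..<i} (\<lambda>_. M))" for i \<omega>
  proof (cases i)
    case 0
    then show ?thesis using x by (simp add: chain_step_def prob_space_return)
  next
    case (Suc n)
    then have "\<omega> n \<in> space M" using that by (auto simp: space_PiM PiE_iff)
    then show ?thesis using measurable_space[OF K] Suc
      by (simp add: chain_step_def space_prob_algebra)
  qed
qed

lemma sets_chain_law: "sets (chain_law M K x) = sets (Pi\<^sub>M UNIV (\<lambda>_. M))"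
  unfolding chain_law_def by simp

text \<open>
The projection of the path law to the first \<open>n\<close> coordinates is the \<open>n\<close>-step composition of the
transition kernels, on which one can compute by unfolding one step.
\<close>

lemma nn_integral_chain_law:
  assumes f[measurable]: "f \<in> borel_measurable (Pi\<^sub>M {0..<n} (\<lambda>_. M))"
  shows "(\<integral>\<^sup>+\<omega>. f (restrict \<omega> {0..<n}) \<partial>chain_law M K x) = (\<integral>\<^sup>+\<omega>. f \<omega> \<partial>IT.C 0 n (\<lambda>_. undefined))"
proof -
  have up: "IT.up_to {0..<n} = n"
  proof (rule antisym)
    show "IT.up_to {0..<n} \<le> n" by (simp add: IT.up_to_iff_Ico)
    show "n \<le> IT.up_to {0..<n}" using IT.up_to[of "{0..<n}"] by (cases n) auto
  qed
  have und: "(\<lambda>_. undefined) \<in> space (Pi\<^sub>M {0..<0::nat} (\<lambda>_. M))" by (simp add: space_PiM)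
  have sets: "sets (IT.C 0 n (\<lambda>_. undefined)) = sets (Pi\<^sub>M {0..<n} (\<lambda>_. M))"
    using IT.sets_C[OF und, of n] by simp
  have "(\<integral>\<^sup>+\<omega>. f (restrict \<omega> {0..<n}) \<partial>chain_law M K x) = (\<integral>\<^sup>+\<omega>. f \<omega> \<partial>IT.CI {0..<n})"
    unfolding chain_law_def
    by (subst IT.distr_lim[symmetric], simp, subst nn_integral_distr)
       (auto simp: measurable_cong_sets[OF IT.PF.sets_lim refl])
  also have "IT.CI {0..<n} = IT.C 0 n (\<lambda>_. undefined)"
    unfolding IT.CI_def up
    using IT.distr_C[of n n "\<lambda>_. undefined" 0] und by simp
  finally show ?thesis .
qed

lemma nn_integral_chain_law_0:
  assumes [measurable]: "g \<in> borel_measurable M"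
  shows "(\<integral>\<^sup>+\<omega>. g (\<omega> 0) \<partial>chain_law M K x) = g x"
proof -
  have und: "(\<lambda>_. undefined) \<in> space (Pi\<^sub>M {0..<0::nat} (\<lambda>_. M))" by (simp add: space_PiM)
  have "(\<integral>\<^sup>+\<omega>. g (\<omega> 0) \<partial>chain_law M K x) = (\<integral>\<^sup>+\<omega>. g (\<omega> 0) \<partial>IT.C 0 1 (\<lambda>_. undefined))"
    using nn_integral_chain_law[of "\<lambda>\<omega>. g (\<omega> 0)" 1] by simp
  also have "\<dots> = (\<integral>\<^sup>+\<omega>. g (\<omega> 0) \<partial>IT.eP 0 (\<lambda>_. undefined))"
    unfolding One_nat_def IT.C.simps add_0 by (subst bind_return[OF IT.measurable_eP und]) (rule refl)
  also have "\<dots> = g x"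
    using und x by (subst IT.nn_integral_eP) (auto simp: chain_step_def nn_integral_return)
  finally show ?thesis .
qed

text \<open>
The Markov property for two consecutive coordinates. It is all that is needed about the joint law,
because the position of the process at a given time depends on two consecutive coordinates only.
\<close>

lemma nn_integral_chain_law_Suc:
  assumes h[measurable]: "(\<lambda>(a, b). h a b) \<in> borel_measurable (M \<Otimes>\<^sub>M M)"
  shows "(\<integral>\<^sup>+\<omega>. h (\<omega> n) (\<omega> (Suc n)) \<partial>chain_law M K x) =
    (\<integral>\<^sup>+\<omega>. \<integral>\<^sup>+z. h (\<omega> n) z \<partial>K (\<omega> n) \<partial>chain_law M K x)"
proof -
  have und: "(\<lambda>_. undefined) \<in> space (Pi\<^sub>M {0..<0::nat} (\<lambda>_. M))" by (simp add: space_PiM)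
  have hm[measurable]: "(\<lambda>\<omega>. h (\<omega> n) (\<omega> (Suc n))) \<in> borel_measurable (Pi\<^sub>M {0..<Suc (Suc n)} (\<lambda>_. M))"
    by (rule measurable_compose[OF _ h, of "\<lambda>\<omega>. (\<omega> n, \<omega> (Suc n))", simplified]) measurable
  have Kh[measurable]: "(\<lambda>a. \<integral>\<^sup>+z. h a z \<partial>K a) \<in> borel_measurable M"
    by (rule nn_integral_measurable_subprob_algebra2[OF h measurable_prob_algebraD[OF K]])
  have sets: "sets (IT.C 0 (Suc n) (\<lambda>_. undefined)) = sets (Pi\<^sub>M {0..<Suc n} (\<lambda>_. M))"
    using IT.sets_C[OF und, of "Suc n"] by simp
  have "(\<integral>\<^sup>+\<omega>. h (\<omega> n) (\<omega> (Suc n)) \<partial>chain_law M K x) =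
      (\<integral>\<^sup>+\<omega>. h (\<omega> n) (\<omega> (Suc n)) \<partial>IT.C 0 (Suc (Suc n)) (\<lambda>_. undefined))"
    using nn_integral_chain_law[OF hm] by simp
  also have "\<dots> = (\<integral>\<^sup>+\<omega>'. \<integral>\<^sup>+\<omega>. h (\<omega> n) (\<omega> (Suc n)) \<partial>IT.eP (Suc n) \<omega>' \<partial>IT.C 0 (Suc n) (\<lambda>_. undefined))"
    unfolding IT.C.simps(2)[of 0 "Suc n"] add_0
    by (rule nn_integral_bind[OF hm]) (simp only: measurable_cong_sets[OF sets refl] IT.measurable_eP)
  also have "\<dots> = (\<integral>\<^sup>+\<omega>. \<integral>\<^sup>+z. h (\<omega> n) z \<partial>K (\<omega> n) \<partial>IT.C 0 (Suc n) (\<lambda>_. undefined))"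
    using sets_eq_imp_space_eq[OF sets]
    by (intro nn_integral_cong) (simp add: IT.nn_integral_eP[OF _ hm] chain_step_def)
  also have "\<dots> = (\<integral>\<^sup>+\<omega>. \<integral>\<^sup>+z. h (\<omega> n) z \<partial>K (\<omega> n) \<partial>chain_law M K x)"
    using nn_integral_chain_law[of "\<lambda>\<omega>. \<integral>\<^sup>+z. h (\<omega> n) z \<partial>K (\<omega> n)" "Suc n"] by simp
  finally show ?thesis .
qed

lemma prob_space_chain_law: "prob_space (chain_law M K x)"
proof (rule prob_spaceI)
  have "(\<integral>\<^sup>+\<omega>. 1 \<partial>chain_law M K x) = 1"
    using nn_integral_chain_law_0[of "\<lambda>_. 1"] by simp
  then show "emeasure (chain_law M K x) (space (chain_law M K x)) = 1" by simp
qed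

end

section \<open>The flow, the jump rate and the jump kernel\<close>

lemma measurable_borel_discrete: "f \<in> N \<rightarrow>\<^sub>M (borel :: 'i::finite_discrete measure) \<Longrightarrow> f \<in> N \<rightarrow>\<^sub>M count_space UNIV"
proof -
  have "sets (borel :: 'i measure) = sets (count_space UNIV)"
    by (auto simp: discrete_topology_class.open_discrete)
  then show "f \<in> N \<rightarrow>\<^sub>M (borel :: 'i measure) \<Longrightarrow> f \<in> N \<rightarrow>\<^sub>M count_space UNIV"
    using measurable_cong_sets[OF refl, of "borel :: 'i measure" "count_space UNIV" N] by simp
qed

text \<open>
The continuity assumptions are made for each fixed mode; as there are only finitely many modes, joint
measurability follows.
\<close>

lemma measurable_compose_discrete:
  assumes "\<And>i::'i::finite_discrete. (\<lambda>w. f i w) \<in> N \<rightarrow>\<^sub>M L" and "g \<in> N \<rightarrow>\<^sub>M borel"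
  shows "(\<lambda>w. f (g w) w) \<in> N \<rightarrow>\<^sub>M L"
  by (rule measurable_compose_countable'[of UNIV f])
     (use assms measurable_borel_discrete in \<open>auto intro: countable_finite\<close>)

lemma borel_measurable_fst_snd[measurable (raw)]:
  fixes f :: "'a \<Rightarrow> 'b::second_countable_topology \<times> 'c::second_countable_topology"
  assumes "f \<in> N \<rightarrow>\<^sub>M borel"
  shows "(\<lambda>w. fst (f w)) \<in> N \<rightarrow>\<^sub>M borel" "(\<lambda>w. snd (f w)) \<in> N \<rightarrow>\<^sub>M borel"
  using assms
  by (auto intro!: measurable_compose[OF assms] borel_measurable_continuous_onI continuous_intros)

lemma space_Xbar: "space Xbar = {b. 0 \<le> snd (snd b)}"
  by (auto simp: Xbar_def space_restrict_space)

lemma nonneg_time_borel: "{b :: 'y::polish_space \<times> 'i::finite_discrete \<times> real. 0 \<le> snd (snd b)} \<in> sets borel"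
  by measurable

lemma measurable_Xbar_borel: "f \<in> borel \<rightarrow>\<^sub>M N \<Longrightarrow> f \<in> Xbar \<rightarrow>\<^sub>M N"
  unfolding Xbar_def by (rule measurable_restrict_space1)

lemma measurable_into_Xbar:
  "f \<in> N \<rightarrow>\<^sub>M borel \<Longrightarrow> (\<And>w. w \<in> space N \<Longrightarrow> 0 \<le> snd (snd (f w))) \<Longrightarrow> f \<in> N \<rightarrow>\<^sub>M Xbar"
  unfolding Xbar_def by (rule measurable_restrict_space2) (auto simp: split_beta)

text \<open>
Functions on the space-time half-space are extended by \<open>0\<close>, so that all computations can be done with
Borel functions on the full product.
\<close>

lemma measurable_extend_Xbar:
  "f \<in> borel_measurable Xbar \<Longrightarrow> (\<lambda>b. f b * indicator (space Xbar) b :: ennreal) \<in> borel_measurable borel"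
  using nonneg_time_borel unfolding Xbar_def space_restrict_space
  by (subst borel_measurable_restrict_space_iff_ennreal[symmetric]) (auto simp: split_beta)

locale switched_flow =
  fixes S :: "'i::finite_discrete \<Rightarrow> real \<Rightarrow> 'y::polish_space \<Rightarrow> 'y"
    and p :: "'i \<Rightarrow> 'i \<Rightarrow> 'y \<Rightarrow> real"
    and lam :: "'y \<Rightarrow> real"
    and J :: "'y \<Rightarrow> 'y measure"
    and lam_min lam_max :: real
  assumes S: "\<And>i. semiflow (S i)"
    and p_cont: "\<And>i j. continuous_on UNIV (p i j)"
    and p_range: "\<And>i j y. 0 \<le> p i j y \<and> p i j y \<le> 1"
    and p_sum: "\<And>i y. (\<Sum>j\<in>UNIV. p i j y) = 1"
    and lam_cont: "continuous_on UNIV lam"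
    and lam_bounds: "0 < lam_min" "0 < lam_max" "\<And>y. lam_min \<le> lam y \<and> lam y \<le> lam_max"
    and J: "J \<in> borel \<rightarrow>\<^sub>M prob_algebra borel"
begin

definition flow :: "real \<Rightarrow> 'y \<times> 'i \<Rightarrow> 'y \<times> 'i" where
  "flow t z = (S (snd z) t (fst z), snd z)"

definition survival :: "'y \<times> 'i \<Rightarrow> real \<Rightarrow> real" where
  "survival z t = exp (- Lam S lam (fst z) (snd z) t)"

text \<open>
The semigroup of the flow killed at the first jump time, extended by \<open>0\<close> to negative times.
\<close>

definition killed :: "real \<Rightarrow> ('y \<times> 'i \<Rightarrow> ennreal) \<Rightarrow> 'y \<times> 'i \<Rightarrow> ennreal" where
  "killed t f z = indicator {0..} t * ennreal (survival z t) * f (flow t z)"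

definition jump :: "('y \<times> 'i \<Rightarrow> ennreal) \<Rightarrow> 'y \<times> 'i \<Rightarrow> ennreal" where
  "jump f z = ennreal (lam (fst z)) *
     (\<integral>\<^sup>+ u. (\<Sum>j\<in>UNIV. ennreal (p (snd z) j u) * f (u, j)) \<partial>J (fst z))"

text \<open>
The jump rate along the trajectory and its integral, extended to negative times (where the flow is
unconstrained) so that both are continuous on the whole line and \<open>hazard\<close> is differentiable at \<open>0\<close>.
\<close>

definition rate :: "'y \<times> 'i \<Rightarrow> real \<Rightarrow> real" where
  "rate z h = lam (fst (flow (max 0 h) z))"

definition hazard :: "'y \<times> 'i \<Rightarrow> real \<Rightarrow> real" where
  "hazard z t = (LBINT h=0..t. rate z h)"

lemma flow_0[simp]: "flow 0 z = z"
  using S by (simp add: flow_def semiflow_def)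

lemma flow_flow: "0 \<le> s \<Longrightarrow> 0 \<le> t \<Longrightarrow> flow s (flow t z) = flow (s + t) z"
  using S by (simp add: flow_def semiflow_def)

lemma measurable_lam[measurable]: "lam \<in> borel_measurable borel"
  using lam_cont by (rule borel_measurable_continuous_onI)

lemma measurable_p[measurable]: "p i j \<in> borel_measurable borel"
  using p_cont by (rule borel_measurable_continuous_onI)

text \<open>
Truncating the time at \<open>0\<close> gives functions that are continuous on the whole line, whatever the values
of \<open>S\<close> at negative times are.
\<close>

lemma continuous_S: "continuous_on UNIV (\<lambda>(t, y). S i (max 0 t) y)"
proof -
  have "continuous_on UNIV ((\<lambda>(t, y). S i t y) \<circ> (\<lambda>(t, y). (max 0 t, y)))"
    using S[of i] unfolding semiflow_def
    by (intro continuous_on_compose)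
       (auto simp: split_beta intro!: continuous_intros elim!: continuous_on_subset)
  then show ?thesis by (simp add: comp_def split_beta)
qed

lemma measurable_flow[measurable (raw)]:
  assumes [measurable]: "t \<in> borel_measurable N" "z \<in> N \<rightarrow>\<^sub>M borel"
  shows "(\<lambda>w. flow (max 0 (t w)) (z w)) \<in> N \<rightarrow>\<^sub>M borel"
proof -
  have S[measurable]: "(\<lambda>(t, y). S i (max 0 t) y) \<in> borel \<rightarrow>\<^sub>M borel" for i
    using continuous_S by (rule borel_measurable_continuous_onI)
  have "(\<lambda>w. S i (max 0 (t w)) (fst (z w))) \<in> N \<rightarrow>\<^sub>M borel" for i
    using measurable_compose[OF _ S[of i], of "\<lambda>w. (t w, fst (z w))" N] by simp
  then have [measurable]: "(\<lambda>w. S (snd (z w)) (max 0 (t w)) (fst (z w))) \<in> N \<rightarrow>\<^sub>M borel"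
    by (rule measurable_compose_discrete) measurable
  show ?thesis unfolding flow_def by measurable
qed

lemma rate_bounds: "lam_min \<le> rate z h" "rate z h \<le> lam_max"
  using lam_bounds by (auto simp: rate_def)

lemma rate_nonneg: "0 \<le> rate z h"
  using rate_bounds(1)[of z h] lam_bounds(1) by simp

lemma continuous_rate: "continuous_on A (rate z)"
proof -
  have pair: "continuous_on A (\<lambda>h::real. (h, fst z))"
    by (intro continuous_on_Pair continuous_on_id continuous_on_const)
  have S: "continuous_on A (\<lambda>h. S (snd z) (max 0 h) (fst z))"
    using continuous_on_compose2[OF continuous_S[of "snd z"] pair] by simp
  have "continuous_on A (\<lambda>h. lam (S (snd z) (max 0 h) (fst z)))"
    by (rule continuous_on_compose2[OF lam_cont S]) simp
  then show ?thesis
    by (simp add: rate_def[abs_def] flow_def)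
qed

lemma hazard_deriv: "(hazard z has_real_derivative rate z t) (at t)"
proof -
  define a where "a = min 0 t - 1"
  define b where "b = max 0 t + 1"
  have "((\<lambda>u. LBINT h=0..u. rate z h) has_vector_derivative rate z t) (at t within {a..b})"
    using interval_integral_FTC2[of a 0 b "rate z" t, OF _ _ continuous_rate]
    by (simp add: a_def b_def zero_ereal_def)
  moreover have "at t within {a..b} = at t"
    by (rule at_within_interior) (auto simp: a_def b_def)
  ultimately show ?thesis
    by (simp add: has_real_derivative_iff_has_vector_derivative hazard_def[abs_def])
qed

lemma hazard_0[simp]: "hazard z 0 = 0"
  by (simp add: hazard_def zero_ereal_def)

lemma hazard_bounds:
  assumes "0 \<le> t"
  shows "lam_min * t \<le> hazard z t" "hazard z t \<le> lam_max * t"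
proof -
  have "hazard z 0 - lam_min * 0 \<le> hazard z t - lam_min * t"
    using assms
    by (intro DERIV_nonneg_imp_nondecreasing[of 0 t "\<lambda>t. hazard z t - lam_min * t"])
       (auto intro!: exI derivative_eq_intros hazard_deriv simp: rate_bounds)
  then show "lam_min * t \<le> hazard z t" by simp
  have "lam_max * 0 - hazard z 0 \<le> lam_max * t - hazard z t"
    using assms
    by (intro DERIV_nonneg_imp_nondecreasing[of 0 t "\<lambda>t. lam_max * t - hazard z t"])
       (auto intro!: exI derivative_eq_intros hazard_deriv simp: rate_bounds)
  then show "hazard z t \<le> lam_max * t" by simp
qed

text \<open>
Both sides have the same derivative in \<open>t\<close>, by the semigroup property of the flow, and agree at
\<open>t = 0\<close>.
\<close>

lemma hazard_add:
  assumes "0 \<le> s" "0 \<le> t"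
  shows "hazard z (s + t) = hazard z s + hazard (flow s z) t"
proof -
  have "\<exists>c. \<forall>u\<in>{0..}. hazard z (s + u) - hazard (flow s z) u = c"
  proof (intro has_field_derivative_zero_constant)
    fix u :: real assume u: "u \<in> {0..}"
    have "rate z (s + u) = rate (flow s z) u"
      using u assms by (simp add: rate_def flow_flow add.commute)
    then show "((\<lambda>u. hazard z (s + u) - hazard (flow s z) u) has_field_derivative 0) (at u within {0..})"
      by (auto intro!: derivative_eq_intros DERIV_chain2[OF hazard_deriv] has_field_derivative_at_within[OF hazard_deriv]
         has_field_derivative_at_within[OF DERIV_chain2[OF hazard_deriv]])
  qed simp
  then obtain c where "\<And>u. 0 \<le> u \<Longrightarrow> hazard z (s + u) - hazard (flow s z) u = c"
    by auto
  from this[of 0] this[of t] assms show ?thesis by simp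
qed

lemma Lam_eq_indicator:
  "Lam S lam (fst z) (snd z) t = (\<integral>h. indicator {0..t} h *\<^sub>R rate z h \<partial>lborel)"
  unfolding Lam_def set_lebesgue_integral_def
  by (intro Bochner_Integration.integral_cong) (auto simp: rate_def flow_def split: split_indicator)

lemma Lam_eq_hazard: "0 \<le> t \<Longrightarrow> Lam S lam (fst z) (snd z) t = hazard z t"
  by (simp add: Lam_eq_indicator hazard_def zero_ereal_def interval_integral_Icc
      set_lebesgue_integral_def)

lemma survival_eq: "0 \<le> t \<Longrightarrow> survival z t = exp (- hazard z t)"
  by (simp add: survival_def Lam_eq_hazard)

lemma survival_add: "0 \<le> s \<Longrightarrow> 0 \<le> t \<Longrightarrow> survival z (s + t) = survival z s * survival (flow s z) t"
  by (simp add: survival_eq hazard_add exp_add[symmetric])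

lemma survival_nonneg[simp]: "0 \<le> survival z t"
  by (simp add: survival_def)

lemma survival_bounds:
  assumes "0 \<le> t"
  shows "exp (- lam_max * t) \<le> survival z t" "survival z t \<le> exp (- lam_min * t)"
  using hazard_bounds[OF assms, of z] by (auto simp: survival_eq[OF assms])

lemma measurable_survival[measurable (raw)]:
  assumes [measurable]: "t \<in> borel_measurable N" "z \<in> N \<rightarrow>\<^sub>M borel"
  shows "(\<lambda>w. survival (z w) (t w)) \<in> borel_measurable N"
proof -
  have ind: "indicator {0..t w} h = (if 0 \<le> h \<and> h \<le> t w then 1 else 0 :: real)" for w h
    by (auto split: split_indicator)
  show ?thesis
    unfolding survival_def Lam_eq_indicator rate_def ind by measurable
qed

text \<open>
The integrand is the density of the first jump time, namely the derivative of \<open>- survival z\<close>; since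
the rate is bounded below, the survival probability tends to \<open>0\<close> at infinity.
\<close>

lemma nn_integral_density_jump_time:
  assumes a: "0 \<le> a"
  shows "(\<integral>\<^sup>+r. ennreal (lam (fst (flow r z)) * survival z r) * indicator {a..} r \<partial>lborel) = ennreal (survival z a)"
proof -
  have cont: "continuous_on UNIV (hazard z)"
    by (intro continuous_at_imp_continuous_on ballI DERIV_isCont[OF hazard_deriv])
  have [measurable]: "(\<lambda>r. rate z r * exp (- hazard z r)) \<in> borel_measurable borel"
    using cont by (intro borel_measurable_continuous_onI continuous_intros continuous_rate)
  have lim: "((\<lambda>r. - exp (- hazard z r)) \<longlongrightarrow> 0) at_top"
  proof (rule Lim_null_comparison)
    show "eventually (\<lambda>r. norm (- exp (- hazard z r)) \<le> exp (- lam_min * r)) at_top"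
      by (rule eventually_mono[OF eventually_ge_at_top[of 0]]) (use hazard_bounds(1)[of _ z] in simp)
    have "filterlim (\<lambda>r. lam_min * r) at_top at_top"
      using lam_bounds(1) by (intro filterlim_tendsto_pos_mult_at_top[OF tendsto_const]) (auto intro: filterlim_ident)
    then have "filterlim (\<lambda>r. - lam_min * r) at_bot at_top"
      by (simp add: filterlim_uminus_at_top)
    then show "((\<lambda>r. exp (- lam_min * r)) \<longlongrightarrow> 0) at_top"
      by (rule filterlim_compose[OF exp_at_bot])
  qed
  have "(\<integral>\<^sup>+r. ennreal (lam (fst (flow r z)) * survival z r) * indicator {a..} r \<partial>lborel) =
      (\<integral>\<^sup>+r. ennreal (rate z r * exp (- hazard z r)) * indicator {a..} r \<partial>lborel)"
    using a by (intro nn_integral_cong) (auto simp: rate_def survival_eq split: split_indicator)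
  also have "\<dots> = ennreal (0 - (- exp (- hazard z a)))"
    by (rule nn_integral_FTC_atLeast[where F="\<lambda>r. - exp (- hazard z r)"])
       (auto intro!: derivative_eq_intros DERIV_chain2[OF hazard_deriv] hazard_deriv lim simp: rate_nonneg)
  finally show ?thesis using a by (simp add: survival_eq)
qed

text \<open>
The function may depend on the parameter \<open>w\<close> as well: this makes iterated operators, and integrals
over time of functions that change with time, measurable without further work.
\<close>

lemma measurable_killed[measurable (raw)]:
  assumes [measurable]: "t \<in> borel_measurable N" "z \<in> N \<rightarrow>\<^sub>M borel"
    and H: "(\<lambda>(w, z). H w z) \<in> borel_measurable (N \<Otimes>\<^sub>M borel)"
  shows "(\<lambda>w. killed (t w) (H w) (z w)) \<in> borel_measurable N"
proof -
  have eq: "killed (t w) (H w) (z w) =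
      (if 0 \<le> t w then ennreal (survival (z w) (t w)) * H w (flow (max 0 (t w)) (z w)) else 0)" for w
    by (auto simp: killed_def)
  have [measurable]: "(\<lambda>w. H w (flow (max 0 (t w)) (z w))) \<in> borel_measurable N"
    by (rule measurable_compose[OF _ H, of "\<lambda>w. (w, flow (max 0 (t w)) (z w))", simplified]) measurable
  show ?thesis unfolding eq by measurable
qed

lemma measurable_jump[measurable (raw)]:
  assumes z[measurable]: "z \<in> N \<rightarrow>\<^sub>M borel"
    and H[measurable]: "(\<lambda>(w, z). H w z) \<in> borel_measurable (N \<Otimes>\<^sub>M borel)"
  shows "(\<lambda>w. jump (H w) (z w)) \<in> borel_measurable N"
proof -
  have p[measurable]: "(\<lambda>(w, u). p (snd (z w)) j u) \<in> borel_measurable (N \<Otimes>\<^sub>M borel)" for j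
    unfolding split_beta by (rule measurable_compose_discrete[of "\<lambda>i w. p i j (snd w)"]) measurable
  have Hj[measurable]: "(\<lambda>(w, u). H w (u, j)) \<in> borel_measurable (N \<Otimes>\<^sub>M borel)" for j
    using measurable_compose[OF _ H, of "\<lambda>(w, u). (w, u, j)" "N \<Otimes>\<^sub>M borel"] by (simp add: split_beta)
  have [measurable]: "(\<lambda>w. J (fst (z w))) \<in> N \<rightarrow>\<^sub>M subprob_algebra borel"
    using measurable_prob_algebraD[OF J] by measurable
  have "(\<lambda>w. \<integral>\<^sup>+ u. (\<Sum>j\<in>UNIV. ennreal (p (snd (z w)) j u) * H w (u, j)) \<partial>J (fst (z w))) \<in> borel_measurable N"
    by (rule nn_integral_measurable_subprob_algebra2[where N=borel]) measurable
  then show ?thesis unfolding jump_def by measurable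
qed


section \<open>The kernels as functionals\<close>

definition occupation :: "('y \<times> 'i \<Rightarrow> ennreal) \<Rightarrow> 'y \<times> 'i \<Rightarrow> ennreal" where
  "occupation f z = (\<integral>\<^sup>+ t. killed t f z \<partial>lborel)"

text \<open>
The action of \<open>Pbar\<close> on functions of location and time: after the waiting time \<open>r\<close>, the jump kernel is
applied to the function at the time increased by \<open>r\<close>.
\<close>

definition transition :: "('y \<times> 'i \<times> real \<Rightarrow> ennreal) \<Rightarrow> 'y \<times> 'i \<times> real \<Rightarrow> ennreal" where
  "transition g b = (\<integral>\<^sup>+ r. killed r (jump (\<lambda>z. g (fst z, snd z, snd (snd b) + r))) (fst b, fst (snd b)) \<partial>lborel)"

lemma lam_nonneg: "0 \<le> lam y"
  using lam_bounds(1) lam_bounds(3)[of y] by simp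

lemma measurable_jump_const[measurable]:
  assumes [measurable]: "f \<in> borel_measurable borel"
  shows "jump f \<in> borel_measurable borel"
proof -
  have "(\<lambda>z. jump f z) \<in> borel_measurable borel" by measurable
  then show ?thesis by simp
qed

lemma measurable_killed_const[measurable]:
  assumes [measurable]: "f \<in> borel_measurable borel"
  shows "killed t f \<in> borel_measurable borel"
proof -
  have "(\<lambda>z. killed t f z) \<in> borel_measurable borel" by measurable
  then show ?thesis by simp
qed

lemma measurable_occupation[measurable]:
  assumes [measurable]: "f \<in> borel_measurable borel"
  shows "occupation f \<in> borel_measurable borel"
  unfolding occupation_def[abs_def] by measurable

lemma measurable_transition[measurable]:
  assumes [measurable]: "g \<in> borel_measurable borel"
  shows "transition g \<in> borel_measurable borel"
  unfolding transition_def[abs_def] by measurable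

lemma sets_J: "sets (J y) = sets borel"
  using measurable_space[OF J, of y] by (simp add: space_prob_algebra)

lemma prob_space_J: "prob_space (J y)"
  using measurable_space[OF J, of y] by (simp add: space_prob_algebra)

lemma nn_functional_jump: "nn_functional borel (\<lambda>f. jump f z)"
  unfolding jump_def
  by (intro nn_functional_scale nn_functional_subst[OF nn_functional_integral[OF sets_J]]
       nn_functional_sum nn_functional_eval) auto

lemma nn_functional_killed: "nn_functional borel (\<lambda>f. killed t f z)"
  unfolding killed_def by (intro nn_functional_scale nn_functional_eval) auto

lemma nn_functional_occupation: "nn_functional borel (\<lambda>f. occupation f z)"
  unfolding occupation_def
proof (rule nn_functional_subst[OF nn_functional_integral[OF refl] nn_functional_killed])
  fix f :: "'y \<times> 'i \<Rightarrow> ennreal" assume [measurable]: "f \<in> borel_measurable borel"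
  show "(\<lambda>t. killed t f z) \<in> borel_measurable lborel" by measurable
qed

lemma jump_const: "jump (\<lambda>_. c) z = ennreal (lam (fst z)) * c"
proof -
  interpret prob_space "J (fst z)" by (rule prob_space_J)
  have "(\<Sum>j\<in>UNIV. ennreal (p (snd z) j u) * c) = c" for u
    using p_range by (simp add: sum_distrib_right[symmetric] sum_ennreal p_sum)
  then show ?thesis by (simp add: jump_def emeasure_space_1)
qed

text \<open>
The density of the first jump time, written in terms of the operators.
\<close>

lemma killed_jump_1: "killed r (jump (\<lambda>_. 1)) z =
    ennreal (lam (fst (flow r z)) * survival z r) * indicator {0..} r"
  by (auto simp: lam_nonneg killed_def jump_const ennreal_mult' mult.commute split: split_indicator)

lemma occupation_jump_1: "occupation (jump (\<lambda>_. 1)) z = 1"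
  using nn_integral_density_jump_time[of 0 z]
  by (simp add: occupation_def killed_jump_1 survival_eq)

lemma
  shows sets_Wtilde: "sets (Wtilde p lam J z) = sets borel"
    and nn_integral_Wtilde: "f \<in> borel_measurable borel \<Longrightarrow> (\<integral>\<^sup>+x. f x \<partial>Wtilde p lam J z) = jump f z"
proof -
  have "Wtilde p lam J z = measure_of (space borel) (sets borel) (\<lambda>A. jump (indicator A) z)"
    by (cases z) (simp add: Wtilde_def jump_def)
  from sets_nn_functional[OF nn_functional_jump this] nn_integral_nn_functional[OF nn_functional_jump this]
  show "sets (Wtilde p lam J z) = sets borel"
    and "f \<in> borel_measurable borel \<Longrightarrow> (\<integral>\<^sup>+x. f x \<partial>Wtilde p lam J z) = jump f z"
    by auto
qed

lemma
  shows sets_Gtilde: "sets (Gtilde S lam z) = sets borel"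
    and nn_integral_Gtilde: "f \<in> borel_measurable borel \<Longrightarrow> (\<integral>\<^sup>+x. f x \<partial>Gtilde S lam z) = occupation f z"
proof -
  have "Gtilde S lam z = measure_of (space borel) (sets borel) (\<lambda>A. occupation (indicator A) z)"
    by (cases z) (simp add: Gtilde_def occupation_def killed_def survival_def flow_def mult_ac)
  from sets_nn_functional[OF nn_functional_occupation this] nn_integral_nn_functional[OF nn_functional_occupation this]
  show "sets (Gtilde S lam z) = sets borel"
    and "f \<in> borel_measurable borel \<Longrightarrow> (\<integral>\<^sup>+x. f x \<partial>Gtilde S lam z) = occupation f z"
    by auto
qed

lemma nn_functional_transition:
  "nn_functional Xbar (\<lambda>g. transition (\<lambda>b. g b * indicator (space Xbar) b) b)"
  unfolding transition_def
proof (rule nn_functional_subst[OF nn_functional_integral[OF refl]])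
  note [measurable] = measurable_extend_Xbar
  show "(\<lambda>r. killed r (jump (\<lambda>z. f (fst z, snd z, snd (snd b) + r) *
        indicator (space Xbar) (fst z, snd z, snd (snd b) + r))) (fst b, fst (snd b)))
      \<in> borel_measurable lborel" if [measurable]: "f \<in> borel_measurable Xbar" for f
  proof -
    have "(\<lambda>b. f b * indicator (space Xbar) b) \<in> borel_measurable borel" by measurable
    from measurable_compose[OF _ this, of "\<lambda>w. (fst (snd w), snd (snd w), snd (snd b) + fst w)" "lborel \<Otimes>\<^sub>M borel"]
    show ?thesis by measurable
  qed
  show "nn_functional Xbar (\<lambda>g. killed r (jump (\<lambda>z. g (fst z, snd z, snd (snd b) + r) *
        indicator (space Xbar) (fst z, snd z, snd (snd b) + r))) (fst b, fst (snd b)))" for r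
  proof (rule nn_functional_subst[OF nn_functional_killed], rule nn_functional_subst[OF nn_functional_jump])
    fix c :: "'y \<times> 'i"
    show "nn_functional Xbar (\<lambda>g. g (fst c, snd c, snd (snd b) + r) *
        indicator (space Xbar) (fst c, snd c, snd (snd b) + r))"
    proof (cases "(fst c, snd c, snd (snd b) + r) \<in> space Xbar")
      case True
      then show ?thesis using nn_functional_eval[OF True] by simp
    qed (simp add: nn_functional_def)
  next
    fix f :: "'y \<times> 'i \<times> real \<Rightarrow> ennreal" assume "f \<in> borel_measurable Xbar"
    then have "(\<lambda>b. f b * indicator (space Xbar) b) \<in> borel_measurable borel" by measurable
    from measurable_compose[OF _ this, of "\<lambda>z. (fst z, snd z, snd (snd b) + r)" borel]
    show m[measurable]: "(\<lambda>z. f (fst z, snd z, snd (snd b) + r) * indicator (space Xbar) (fst z, snd z, snd (snd b) + r))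
       \<in> borel_measurable borel" by measurable
    show "jump (\<lambda>z. f (fst z, snd z, snd (snd b) + r) * indicator (space Xbar) (fst z, snd z, snd (snd b) + r))
       \<in> borel_measurable borel" by measurable
  qed
qed

text \<open>
Time only increases, so from a nonnegative time only values at nonnegative times are seen.
\<close>

lemma transition_cong_Xbar:
  assumes "b \<in> space Xbar" "\<And>c. c \<in> space Xbar \<Longrightarrow> f c = g c"
  shows "transition f b = transition g b"
proof -
  have "killed r (jump (\<lambda>z. f (fst z, snd z, snd (snd b) + r))) (fst b, fst (snd b)) =
     killed r (jump (\<lambda>z. g (fst z, snd z, snd (snd b) + r))) (fst b, fst (snd b))" for r
    using assms by (cases "0 \<le> r") (auto simp: killed_def space_Xbar)
  then show ?thesis by (simp add: transition_def)
qed

abbreviation (input) "PB \<equiv> Pbar S p lam J"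

lemma
  assumes b: "b \<in> space Xbar"
  shows sets_Pbar: "sets (PB b) = sets Xbar"
    and emeasure_Pbar: "A \<in> sets Xbar \<Longrightarrow> emeasure (PB b) A = transition (indicator A) b"
    and nn_integral_Pbar: "g \<in> borel_measurable Xbar \<Longrightarrow>
      (\<integral>\<^sup>+c. g c \<partial>PB b) = transition (\<lambda>b. g b * indicator (space Xbar) b) b"
    and nn_integral_Pbar_borel: "g \<in> borel_measurable borel \<Longrightarrow> (\<integral>\<^sup>+c. g c \<partial>PB b) = transition g b"
proof -
  have ind: "transition (\<lambda>b. indicator A b * indicator (space Xbar) b) b = transition (indicator A) b" for A
    using b by (rule transition_cong_Xbar) simp
  obtain y i s where b_eq: "b = (y, i, s)" by (cases b)
  have "PB b = measure_of (space Xbar) (sets Xbar) (\<lambda>A. transition (indicator A) b)"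
    unfolding Pbar_def b_eq prod.case transition_def fst_conv snd_conv
    by (intro arg_cong[where f="measure_of _ _"] ext nn_integral_cong)
       (auto simp: killed_def jump_def survival_def flow_def ennreal_mult' lam_nonneg
         mult_ac split: split_indicator)
  then have eq: "PB b = measure_of (space Xbar) (sets Xbar)
      (\<lambda>A. transition (\<lambda>b. indicator A b * indicator (space Xbar) b) b)"
    by (simp only: ind)
  show "sets (PB b) = sets Xbar" by (rule sets_nn_functional[OF nn_functional_transition eq])
  show "emeasure (PB b) A = transition (indicator A) b" if "A \<in> sets Xbar"
    using emeasure_nn_functional[OF nn_functional_transition eq that] by (simp only: ind)
  show *: "(\<integral>\<^sup>+c. g c \<partial>PB b) = transition (\<lambda>b. g b * indicator (space Xbar) b) b"
    if "g \<in> borel_measurable Xbar" for g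
    by (rule nn_integral_nn_functional[OF nn_functional_transition eq that])
  show "(\<integral>\<^sup>+c. g c \<partial>PB b) = transition g b" if "g \<in> borel_measurable borel"
    using *[OF measurable_Xbar_borel[OF that]] transition_cong_Xbar[OF b, of "\<lambda>b. g b * indicator (space Xbar) b" g]
    by simp
qed

lemma transition_1: "transition (\<lambda>_. 1) b = 1"
  using occupation_jump_1 by (simp add: transition_def occupation_def)

lemma measurable_Pbar: "PB \<in> Xbar \<rightarrow>\<^sub>M prob_algebra Xbar"
proof (rule measurable_prob_algebraI)
  show prob: "prob_space (PB b)" if "b \<in> space Xbar" for b
  proof (rule prob_spaceI)
    have "(\<integral>\<^sup>+c. 1 \<partial>PB b) = transition (\<lambda>_. 1) b"
      using that by (rule nn_integral_Pbar_borel) measurable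
    also have "\<dots> = 1"
      by (rule transition_1)
    finally show "emeasure (PB b) (space (PB b)) = 1" by simp
  qed
  show "PB \<in> Xbar \<rightarrow>\<^sub>M subprob_algebra Xbar"
  proof (rule measurable_subprob_algebra)
    show "(\<lambda>b. emeasure (PB b) A) \<in> borel_measurable Xbar" if A: "A \<in> sets Xbar" for A
    proof -
      have "A \<in> sets borel"
        using A nonneg_time_borel unfolding Xbar_def by (auto simp: sets_restrict_space split_beta)
      then have "transition (indicator A) \<in> borel_measurable Xbar"
        by (intro measurable_Xbar_borel measurable_transition) simp
      then show ?thesis by (simp add: emeasure_Pbar[OF _ A] cong: measurable_cong)
    qed
  qed (auto simp: sets_Pbar prob prob_space_imp_subprob_space)
qed

lemma Pker_eq_distr: "Pker S p lam J z = distr (PB (fst z, snd z, 0)) borel (\<lambda>b. (fst b, fst (snd b)))"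
proof -
  have "(\<lambda>(u, j, s). (u, j)) = (\<lambda>b :: 'y \<times> 'i \<times> real. (fst b, fst (snd b)))" by auto
  then show ?thesis by (cases z) (simp add: Pker_def)
qed

lemma sets_Pker: "sets (Pker S p lam J z) = sets borel"
  by (simp add: Pker_eq_distr)

lemma nn_integral_Pker:
  assumes f[measurable]: "f \<in> borel_measurable borel"
  shows "(\<integral>\<^sup>+x. f x \<partial>Pker S p lam J z) = occupation (jump f) z"
proof -
  have b: "(fst z, snd z, 0) \<in> space Xbar" by (simp add: space_Xbar)
  have [measurable]: "(\<lambda>b. (fst b, fst (snd b))) \<in> PB (fst z, snd z, 0) \<rightarrow>\<^sub>M borel"
    unfolding measurable_cong_sets[OF sets_Pbar[OF b] refl] by (rule measurable_Xbar_borel) measurable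
  have "(\<integral>\<^sup>+x. f x \<partial>Pker S p lam J z) = (\<integral>\<^sup>+b. f (fst b, fst (snd b)) \<partial>PB (fst z, snd z, 0))"
    unfolding Pker_eq_distr by (rule nn_integral_distr) measurable
  also have "\<dots> = transition (\<lambda>b. f (fst b, fst (snd b))) (fst z, snd z, 0)"
    by (rule nn_integral_Pbar_borel[OF b]) measurable
  also have "\<dots> = occupation (jump f) z"
    by (simp add: transition_def occupation_def)
  finally show ?thesis .
qed


section \<open>The transition semigroup as a sum over the number of jumps\<close>

definition path_law :: "'y \<times> 'i \<Rightarrow> (nat \<Rightarrow> 'y \<times> 'i \<times> real) measure" where
  "path_law z = chain_law Xbar PB (fst z, snd z, 0)"

text \<open>
At a post-jump location with its jump time, this is the contribution to the expectation of \<open>f\<close> at time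
\<open>t\<close> of the event that the next jump is later than \<open>t\<close>. It vanishes if the jump time exceeds \<open>t\<close>.
\<close>

definition alive :: "real \<Rightarrow> ('y \<times> 'i \<Rightarrow> ennreal) \<Rightarrow> 'y \<times> 'i \<times> real \<Rightarrow> ennreal" where
  "alive t f b = killed (t - snd (snd b)) f (fst b, fst (snd b))"

lemma measurable_alive[measurable]:
  assumes [measurable]: "f \<in> borel_measurable borel"
  shows "alive t f \<in> borel_measurable borel"
  unfolding alive_def[abs_def] by measurable

lemma start_in_Xbar: "(y, i, 0) \<in> space Xbar"
  by (simp add: space_Xbar)

lemma sets_path_law: "sets (path_law z) = sets (Pi\<^sub>M UNIV (\<lambda>_. Xbar))"
  unfolding path_law_def by (rule sets_chain_law[OF measurable_Pbar start_in_Xbar])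

lemma measurable_path_law: "borel_measurable (path_law z) = borel_measurable (Pi\<^sub>M UNIV (\<lambda>_. Xbar))"
  "(path_law z) \<rightarrow>\<^sub>M N = (Pi\<^sub>M UNIV (\<lambda>_. Xbar)) \<rightarrow>\<^sub>M N"
  by (rule measurable_cong_sets[OF sets_path_law refl])+

lemma space_path_law: "\<omega> \<in> space (path_law z) \<Longrightarrow> \<omega> n \<in> space Xbar"
  using sets_eq_imp_space_eq[OF sets_path_law[of z]] by (auto simp: space_PiM PiE_iff)

lemma prob_space_path_law: "prob_space (path_law z)"
  unfolding path_law_def by (rule prob_space_chain_law[OF measurable_Pbar start_in_Xbar])

lemma measurable_coordinate[measurable]: "(\<lambda>\<omega>. \<omega> n) \<in> Pi\<^sub>M UNIV (\<lambda>_. Xbar) \<rightarrow>\<^sub>M borel"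
proof -
  have "(\<lambda>b. b) \<in> Xbar \<rightarrow>\<^sub>M borel" by (rule measurable_Xbar_borel) measurable
  from measurable_compose[OF measurable_component_singleton[of n UNIV "\<lambda>_. Xbar"] this]
  show ?thesis by simp
qed

lemma measurable_coordinate_path_law[measurable]: "(\<lambda>\<omega>. \<omega> n) \<in> path_law z \<rightarrow>\<^sub>M borel"
  unfolding measurable_path_law by measurable

lemma measurable_tau[measurable]: "(\<lambda>\<omega>. tau \<omega> n) \<in> borel_measurable (Pi\<^sub>M UNIV (\<lambda>_. Xbar))"
  unfolding tau_def by measurable

text \<open>
On the event in question the elapsed time is nonnegative, so truncating it changes nothing; the
truncated flow is measurable.
\<close>

lemma Psi_eq:
  "Psi S t \<omega> =
     (if \<exists>n. tau \<omega> n \<le> t \<and> t < tau \<omega> (Suc n)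
      then (let b = \<omega> (LEAST n. tau \<omega> n \<le> t \<and> t < tau \<omega> (Suc n)) in
        flow (max 0 (t - snd (snd b))) (fst b, fst (snd b)))
      else (fst (\<omega> 0), fst (snd (\<omega> 0))))"
proof (cases "\<exists>n. tau \<omega> n \<le> t \<and> t < tau \<omega> (Suc n)")
  case True
  define N where "N = (LEAST n. tau \<omega> n \<le> t \<and> t < tau \<omega> (Suc n))"
  have "tau \<omega> N \<le> t" using LeastI_ex[OF True] by (simp add: N_def)
  then have "snd (snd (\<omega> N)) \<le> t" by (simp add: tau_def)
  with True show ?thesis
    by (simp add: Psi_def N_def[symmetric] Let_def flow_def split_beta max_absorb2)
qed (auto simp: Psi_def split_beta)

lemma measurable_Psi[measurable]: "Psi S t \<in> Pi\<^sub>M UNIV (\<lambda>_. Xbar) \<rightarrow>\<^sub>M borel"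
proof -
  have [measurable]: "(\<lambda>\<omega>. \<omega> (LEAST n. tau \<omega> n \<le> t \<and> t < tau \<omega> (Suc n))) \<in> Pi\<^sub>M UNIV (\<lambda>_. Xbar) \<rightarrow>\<^sub>M borel"
    by (rule measurable_compose_countable) measurable
  show ?thesis
    unfolding Psi_eq[abs_def] Let_def by measurable
qed

lemma nn_integral_path_law_0:
  assumes "g \<in> borel_measurable borel"
  shows "(\<integral>\<^sup>+\<omega>. g (\<omega> 0) \<partial>path_law z) = g (fst z, snd z, 0)"
  unfolding path_law_def
  by (rule nn_integral_chain_law_0[OF measurable_Pbar start_in_Xbar measurable_Xbar_borel[OF assms]])

text \<open>
The Markov property, with the kernel replaced by its action on functions.
\<close>

lemma nn_integral_path_law_pair:
  assumes h[measurable]: "(\<lambda>w. h (fst w) (snd w)) \<in> borel_measurable borel"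
  shows "(\<integral>\<^sup>+\<omega>. h (\<omega> n) (\<omega> (Suc n)) \<partial>path_law z) = (\<integral>\<^sup>+\<omega>. transition (h (\<omega> n)) (\<omega> n) \<partial>path_law z)"
proof -
  have id: "(\<lambda>b. b) \<in> Xbar \<rightarrow>\<^sub>M borel" by (rule measurable_Xbar_borel) measurable
  have pair: "(\<lambda>w. w) \<in> Xbar \<Otimes>\<^sub>M Xbar \<rightarrow>\<^sub>M borel"
    using measurable_Pair[OF measurable_compose[OF measurable_fst id] measurable_compose[OF measurable_snd id]]
    by (simp add: borel_prod)
  have hX: "(\<lambda>(a, b). h a b) \<in> borel_measurable (Xbar \<Otimes>\<^sub>M Xbar)"
    using measurable_compose[OF pair h] by (simp add: split_beta)
  have ha: "h a \<in> borel_measurable borel" for a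
    using measurable_compose[OF _ h, of "\<lambda>b. (a, b)" borel] by simp
  have "(\<integral>\<^sup>+\<omega>. h (\<omega> n) (\<omega> (Suc n)) \<partial>path_law z) =
      (\<integral>\<^sup>+\<omega>. \<integral>\<^sup>+c. h (\<omega> n) c \<partial>PB (\<omega> n) \<partial>path_law z)"
    unfolding path_law_def by (rule nn_integral_chain_law_Suc[OF measurable_Pbar start_in_Xbar hX])
  also have "\<dots> = (\<integral>\<^sup>+\<omega>. transition (h (\<omega> n)) (\<omega> n) \<partial>path_law z)"
    by (intro nn_integral_cong nn_integral_Pbar_borel ha space_path_law)
  finally show ?thesis .
qed

lemma nn_integral_path_law_Suc:
  assumes [measurable]: "g \<in> borel_measurable borel"
  shows "(\<integral>\<^sup>+\<omega>. g (\<omega> (Suc n)) \<partial>path_law z) = (\<integral>\<^sup>+\<omega>. transition g (\<omega> n) \<partial>path_law z)"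
  by (rule nn_integral_path_law_pair[of "\<lambda>_. g"]) measurable

lemma measurable_transition_iterate:
  "g \<in> borel_measurable borel \<Longrightarrow> (transition ^^ n) g \<in> borel_measurable borel"
  by (induction n) auto

lemma nn_integral_path_law:
  "g \<in> borel_measurable borel \<Longrightarrow>
    (\<integral>\<^sup>+\<omega>. g (\<omega> n) \<partial>path_law z) = (transition ^^ n) g (fst z, snd z, 0)"
proof (induction n arbitrary: g)
  case (Suc n)
  then show ?case
    using Suc.IH[OF measurable_transition[OF Suc.prems]]
    by (simp add: nn_integral_path_law_Suc funpow_Suc_right del: funpow.simps)
qed (simp add: nn_integral_path_law_0)

lemma AE_tau_0: "AE \<omega> in path_law z. tau \<omega> 0 = 0"
proof -
  have "(\<integral>\<^sup>+\<omega>. (if snd (snd (\<omega> 0)) = 0 then 0 else 1) \<partial>path_law z) = 0"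
    by (subst nn_integral_path_law_0[of "\<lambda>b. if snd (snd b) = 0 then 0 else 1"]) auto
  then have "AE \<omega> in path_law z. (if snd (snd (\<omega> 0)) = 0 then 0 else 1 :: ennreal) = 0"
    by (subst (asm) nn_integral_0_iff_AE) auto
  then show ?thesis by eventually_elim (simp add: tau_def split: if_splits)
qed

lemma AE_tau_mono: "AE \<omega> in path_law z. tau \<omega> n \<le> tau \<omega> (Suc n)"
proof -
  define h :: "'y \<times> 'i \<times> real \<Rightarrow> 'y \<times> 'i \<times> real \<Rightarrow> ennreal"
    where "h a b = (if snd (snd a) \<le> snd (snd b) then 0 else 1)" for a b
  have [measurable]: "(\<lambda>w. h (fst w) (snd w)) \<in> borel_measurable borel"
    unfolding h_def by measurable
  have "killed r (jump (\<lambda>c. h a (fst c, snd c, snd (snd a) + r))) (fst a, fst (snd a)) = 0" for a r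
    by (cases "0 \<le> r") (auto simp: killed_def h_def jump_const)
  then have "transition (h a) a = 0" for a by (simp add: transition_def)
  then have "(\<integral>\<^sup>+\<omega>. h (\<omega> n) (\<omega> (Suc n)) \<partial>path_law z) = 0"
    by (subst nn_integral_path_law_pair) auto
  then have "AE \<omega> in path_law z. h (\<omega> n) (\<omega> (Suc n)) = 0"
    by (subst (asm) nn_integral_0_iff_AE) (auto simp: h_def)
  then show ?thesis by eventually_elim (simp add: tau_def h_def split: if_splits)
qed

lemma nn_integral_exp_decay:
  assumes "0 < (a::real)"
  shows "(\<integral>\<^sup>+r. ennreal (exp (- (a * r))) * indicator {0..} r \<partial>lborel) = ennreal (1 / a)"
proof -
  have "filterlim (\<lambda>r. a * r) at_top at_top"
    using assms by (intro filterlim_tendsto_pos_mult_at_top[OF tendsto_const]) (auto intro: filterlim_ident)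
  then have "filterlim (\<lambda>r. - (a * r)) at_bot at_top"
    by (simp add: filterlim_uminus_at_top)
  then have "((\<lambda>r. - (exp (- (a * r)) / a)) \<longlongrightarrow> - (0 / a)) at_top"
    using assms by (intro tendsto_intros filterlim_compose[OF exp_at_bot]) auto
  then have "(\<integral>\<^sup>+r. ennreal (exp (- (a * r))) * indicator {0..} r \<partial>lborel) = ennreal (0 - (- (exp (- (a * 0)) / a)))"
    using assms
    by (intro nn_integral_FTC_atLeast[where F="\<lambda>r. - (exp (- (a * r)) / a)"])
       (auto intro!: derivative_eq_intros)
  then show ?thesis by simp
qed

text \<open>
A Lyapunov function for the jump times: a waiting time has a density bounded by \<open>lam_max\<close>, hence
\<open>E[exp (- a T)] \<le> lam_max / a\<close>, and \<open>a = 2 lam_max\<close> makes this factor \<open>1/2\<close>.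
\<close>

definition discount :: "'y \<times> 'i \<times> real \<Rightarrow> ennreal" where
  "discount b = ennreal (exp (- (2 * lam_max * snd (snd b))))"

lemma measurable_discount[measurable]: "discount \<in> borel_measurable borel"
  unfolding discount_def[abs_def] by measurable

lemma transition_discount: "transition discount b \<le> ennreal (1 / 2) * discount b"
proof -
  define s where "s = snd (snd b)"
  have le: "killed r (jump (\<lambda>z. discount (fst z, snd z, s + r))) (fst b, fst (snd b)) \<le>
      ennreal lam_max * discount b * (ennreal (exp (- ((2 * lam_max) * r))) * indicator {0..} r)" for r
  proof (cases "0 \<le> r")
    case True
    let ?z = "(fst b, fst (snd b))"
    have "survival ?z r \<le> 1"
      using survival_bounds(2)[OF True, of ?z] lam_bounds(1) True
      by (intro order_trans[OF survival_bounds(2)[OF True]]) simp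
    then have "survival ?z r * (lam (fst (flow r ?z)) * exp (- (2 * lam_max * (s + r)))) \<le>
        1 * (lam_max * exp (- (2 * lam_max * (s + r))))"
      using lam_nonneg lam_bounds(2,3) by (intro mult_mono) (auto intro: less_imp_le)
    also have "\<dots> = lam_max * exp (- (2 * lam_max * s)) * exp (- ((2 * lam_max) * r))"
      by (simp add: exp_add[symmetric] algebra_simps)
    finally show ?thesis
      using True lam_bounds(2) lam_nonneg
      by (simp add: killed_def jump_const discount_def s_def ennreal_mult'[symmetric] ennreal_leI)
  qed (simp add: killed_def)
  have "transition discount b \<le> (\<integral>\<^sup>+r. ennreal lam_max * discount b * (ennreal (exp (- ((2 * lam_max) * r))) * indicator {0..} r) \<partial>lborel)"
    unfolding transition_def s_def[symmetric] by (intro nn_integral_mono le)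
  also have "\<dots> = ennreal lam_max * discount b * ennreal (1 / (2 * lam_max))"
    using lam_bounds(2) by (subst nn_integral_cmult) (auto simp: nn_integral_exp_decay)
  also have "\<dots> = ennreal (lam_max * exp (- (2 * lam_max * s)) * (1 / (2 * lam_max)))"
    using lam_bounds(2) by (simp only: discount_def s_def ennreal_mult'[symmetric] ennreal_mult''[symmetric]
       less_imp_le exp_ge_zero mult_nonneg_nonneg zero_le_divide_1_iff zero_le_mult_iff zero_le_numeral simp_thms)
  also have "lam_max * exp (- (2 * lam_max * s)) * (1 / (2 * lam_max)) = 1 / 2 * exp (- (2 * lam_max * s))"
    using lam_bounds(2) by simp
  also have "ennreal \<dots> = ennreal (1 / 2) * discount b"
    unfolding discount_def s_def by (rule ennreal_mult') simp
  finally show ?thesis .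
qed

lemma nn_integral_discount_le: "(\<integral>\<^sup>+\<omega>. discount (\<omega> n) \<partial>path_law z) \<le> ennreal ((1 / 2) ^ n)"
proof (induction n)
  case 0
  show ?case unfolding nn_integral_path_law_0[OF measurable_discount] by (simp add: discount_def)
next
  case (Suc n)
  have "(\<integral>\<^sup>+\<omega>. discount (\<omega> (Suc n)) \<partial>path_law z) = (\<integral>\<^sup>+\<omega>. transition discount (\<omega> n) \<partial>path_law z)"
    by (rule nn_integral_path_law_Suc) measurable
  also have "\<dots> \<le> (\<integral>\<^sup>+\<omega>. ennreal (1 / 2) * discount (\<omega> n) \<partial>path_law z)"
    by (intro nn_integral_mono transition_discount)
  also have "\<dots> = ennreal (1 / 2) * (\<integral>\<^sup>+\<omega>. discount (\<omega> n) \<partial>path_law z)"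
    by (rule nn_integral_cmult) measurable
  also have "\<dots> \<le> ennreal (1 / 2) * ennreal ((1 / 2) ^ n)"
    by (intro mult_left_mono Suc.IH) simp
  also have "\<dots> = ennreal ((1 / 2) ^ Suc n)"
    by (subst ennreal_mult'[symmetric]) simp_all
  finally show ?case .
qed

text \<open>
If no jump time exceeds \<open>t\<close>, then every \<open>discount (\<omega> n)\<close> is at least \<open>exp (- 2 lam_max t)\<close>, while
its expectation decays like \<open>(1/2)^n\<close>.
\<close>

lemma AE_tau_unbounded: "AE \<omega> in path_law z. \<exists>n. t < tau \<omega> n"
proof -
  define c where "c = exp (2 * lam_max * t)"
  define bad :: "_ \<Rightarrow> ennreal" where "bad \<omega> = (if \<exists>n. t < tau \<omega> n then 0 else 1)" for \<omega> :: "nat \<Rightarrow> 'y \<times> 'i \<times> real"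
  have [measurable]: "bad \<in> borel_measurable (path_law z)"
    unfolding measurable_path_law bad_def[abs_def] by measurable
  have "(\<integral>\<^sup>+\<omega>. bad \<omega> \<partial>path_law z) \<le> ennreal (c * (1 / 2) ^ n)" for n
  proof -
    have le: "bad \<omega> \<le> ennreal c * discount (\<omega> n)" for \<omega>
    proof (cases "\<exists>n. t < tau \<omega> n")
      case False
      then have "snd (snd (\<omega> n)) \<le> t" by (auto simp: tau_def not_less)
      then have "0 \<le> 2 * lam_max * t + - (2 * lam_max * snd (snd (\<omega> n)))"
        using lam_bounds(2) by simp
      then have "1 \<le> exp (2 * lam_max * t + - (2 * lam_max * snd (snd (\<omega> n))))"
        by (simp only: one_le_exp_iff)
      then have "1 \<le> c * exp (- (2 * lam_max * snd (snd (\<omega> n))))"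
        by (simp only: exp_add c_def)
      then show ?thesis
        using False by (simp add: bad_def discount_def ennreal_mult''[symmetric])
    qed (simp add: bad_def)
    have "(\<integral>\<^sup>+\<omega>. bad \<omega> \<partial>path_law z) \<le> (\<integral>\<^sup>+\<omega>. ennreal c * discount (\<omega> n) \<partial>path_law z)"
      by (intro nn_integral_mono le)
    also have "\<dots> = ennreal c * (\<integral>\<^sup>+\<omega>. discount (\<omega> n) \<partial>path_law z)"
      by (rule nn_integral_cmult) measurable
    also have "\<dots> \<le> ennreal c * ennreal ((1 / 2) ^ n)"
      by (intro mult_left_mono nn_integral_discount_le) simp
    finally show ?thesis by (simp add: c_def ennreal_mult'[symmetric])
  qed
  moreover have "(\<lambda>n. ennreal (c * (1 / 2) ^ n)) \<longlonglongrightarrow> ennreal (c * 0)"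
    by (intro tendsto_ennrealI tendsto_mult tendsto_const LIMSEQ_realpow_zero) auto
  ultimately have "(\<integral>\<^sup>+\<omega>. bad \<omega> \<partial>path_law z) \<le> ennreal (c * 0)"
    by (intro LIMSEQ_le_const) auto
  then have "AE \<omega> in path_law z. bad \<omega> = 0"
    by (subst nn_integral_0_iff_AE[symmetric]) auto
  then show ?thesis by eventually_elim (auto simp: bad_def split: if_splits)
qed

text \<open>
The next jump occurs after time \<open>t\<close> with probability \<open>survival\<close> for the remaining time.
\<close>

lemma transition_survive:
  assumes "snd (snd b) \<le> t"
  shows "transition (\<lambda>c. if t < snd (snd c) then k else 0) b =
    ennreal (survival (fst b, fst (snd b)) (t - snd (snd b))) * k"
proof -
  define s where "s = snd (snd b)"
  define z where "z = (fst b, fst (snd b))"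
  let ?d = "\<lambda>r. ennreal (lam (fst (flow r z)) * survival z r)"
  \<comment> \<open>At \<open>r = t - s\<close> the strict and the weak inequality differ; this is a null set.\<close>
  have eq: "killed r (jump (\<lambda>c. if t < s + r then k else 0)) z = ?d r * indicator {t - s..} r * k" if "r \<noteq> t - s" for r
    using that assms
    by (cases "0 \<le> r"; cases "t < s + r") (auto simp: killed_def jump_const ennreal_mult' lam_nonneg s_def mult_ac
      split: split_indicator)
  have [measurable]: "(\<lambda>r. ?d r * indicator {t - s..} r) \<in> borel_measurable lborel"
  proof -
    have "(\<lambda>r. ?d r * indicator {t - s..} r) =
        (\<lambda>r. ennreal (lam (fst (flow (max 0 r) z)) * survival z r) * indicator {t - s..} r)"
      using assms by (auto simp: fun_eq_iff s_def split: split_indicator)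
    also have "\<dots> \<in> borel_measurable lborel" by measurable
    finally show ?thesis .
  qed
  have "transition (\<lambda>c. if t < snd (snd c) then k else 0) b = (\<integral>\<^sup>+r. ?d r * indicator {t - s..} r * k \<partial>lborel)"
    unfolding transition_def snd_conv s_def[symmetric] z_def[symmetric]
  proof (rule nn_integral_cong_AE)
    show "AE r in lborel. killed r (jump (\<lambda>c. if t < s + r then k else 0)) z = ?d r * indicator {t - s..} r * k"
      using AE_lborel_singleton[of "t - s"] by eventually_elim (rule eq)
  qed
  also have "\<dots> = (\<integral>\<^sup>+r. ?d r * indicator {t - s..} r \<partial>lborel) * k"
    by (rule nn_integral_multc) measurable
  also have "\<dots> = ennreal (survival z (t - s)) * k"
    using assms by (subst nn_integral_density_jump_time) (auto simp: s_def)
  finally show ?thesis by (simp add: s_def z_def)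
qed

lemma sets_Pt: "sets (Pt S p lam J t z) = sets borel"
  by (cases z) (simp add: Pt_def)

lemma Pt_eq_distr: "Pt S p lam J t z = distr (path_law z) borel (Psi S t)"
  by (cases z) (simp add: Pt_def path_law_def)

lemma prob_space_Pt: "prob_space (Pt S p lam J t z)"
  unfolding Pt_eq_distr
  by (intro prob_space.prob_space_distr prob_space_path_law) (simp add: measurable_path_law measurable_Psi)

text \<open>
Almost surely the jump times start at \<open>0\<close>, increase and are unbounded, so exactly one \<open>n\<close> satisfies
\<open>\<tau>\<^sub>n \<le> t < \<tau>\<^sub>n\<^sub>+\<^sub>1\<close>, and \<open>f (\<Psi> t)\<close> is a sum over \<open>n\<close> with one nonzero term. Integrating out the
next jump time in each term turns the condition \<open>t < \<tau>\<^sub>n\<^sub>+\<^sub>1\<close> into a survival probability.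
\<close>

lemma nn_integral_Pt:
  assumes t: "0 \<le> t" and f[measurable]: "f \<in> borel_measurable borel"
  shows "(\<integral>\<^sup>+x. f x \<partial>Pt S p lam J t z) = (\<Sum>n. \<integral>\<^sup>+\<omega>. alive t f (\<omega> n) \<partial>path_law z)"
proof -
  \<comment> \<open>The value of \<open>f (\<Psi> t)\<close> if \<open>a\<close> is the last jump up to time \<open>t\<close> and \<open>b\<close> the next one, else \<open>0\<close>.\<close>
  define h :: "'y \<times> 'i \<times> real \<Rightarrow> 'y \<times> 'i \<times> real \<Rightarrow> ennreal"
    where "h a b = (if snd (snd a) \<le> t \<and> t < snd (snd b)
      then f (flow (max 0 (t - snd (snd a))) (fst a, fst (snd a))) else 0)" for a b
  have [measurable]: "(\<lambda>w. h (fst w) (snd w)) \<in> borel_measurable borel"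
    unfolding h_def by measurable
  have [measurable]: "(\<lambda>\<omega>. h (\<omega> n) (\<omega> (Suc n))) \<in> borel_measurable (path_law z)" for n
    unfolding h_def by measurable
  have transition: "transition (h a) a = alive t f a" for a
  proof (cases "snd (snd a) \<le> t")
    case True
    then show ?thesis
      using transition_survive[OF True, of "f (flow (max 0 (t - snd (snd a))) (fst a, fst (snd a)))"]
      by (simp add: h_def[abs_def] alive_def killed_def max_absorb2)
  next
    case False
    then have "transition (h a) a = transition (\<lambda>_. 0) a" by (simp add: h_def[abs_def])
    also have "\<dots> = 0" by (simp add: transition_def jump_const killed_def)
    finally show ?thesis using False by (simp add: alive_def killed_def)
  qed
  have "AE \<omega> in path_law z. f (Psi S t \<omega>) = (\<Sum>n. h (\<omega> n) (\<omega> (Suc n)))"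
  proof -
    have mono: "AE \<omega> in path_law z. \<forall>n. tau \<omega> n \<le> tau \<omega> (Suc n)"
      unfolding AE_all_countable by (intro allI AE_tau_mono)
    have Psi: "f (Psi S t \<omega>) = (\<Sum>n. h (\<omega> n) (\<omega> (Suc n)))"
      if start: "tau \<omega> 0 = 0" and ub: "\<exists>n. t < tau \<omega> n"
        and mono: "\<forall>n. tau \<omega> n \<le> tau \<omega> (Suc n)" for \<omega>
    proof -
      have inc: "tau \<omega> m \<le> tau \<omega> n" if "m \<le> n" for m n
        using lift_Suc_mono_le[of "tau \<omega>" m n] that mono by blast
      define N where "N = (LEAST n. t < tau \<omega> n) - 1"
      have "t < tau \<omega> (LEAST n. t < tau \<omega> n)" using ub by (rule LeastI_ex)
      moreover from this have "(LEAST n. t < tau \<omega> n) \<noteq> 0"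
        using t start by (cases "LEAST n. t < tau \<omega> n") auto
      ultimately have SucN: "t < tau \<omega> (Suc N)" and "N < (LEAST n. t < tau \<omega> n)"
        by (auto simp: N_def)
      then have N: "tau \<omega> N \<le> t" using not_less_Least by force
      have uniq: "n = N" if "tau \<omega> n \<le> t" "t < tau \<omega> (Suc n)" for n
      proof (rule antisym)
        show "n \<le> N" using inc[of "Suc N" n] that SucN by (cases "n \<le> N") auto
        show "N \<le> n" using inc[of "Suc n" N] that N by (cases "N \<le> n") auto
      qed
      have least: "(LEAST n. tau \<omega> n \<le> t \<and> t < tau \<omega> (Suc n)) = N"
      proof (rule Least_equality)
        show "tau \<omega> N \<le> t \<and> t < tau \<omega> (Suc N)" using N SucN by simp
        show "N \<le> n" if "tau \<omega> n \<le> t \<and> t < tau \<omega> (Suc n)" for n using uniq[of n] that by simp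
      qed
      define c where "c = h (\<omega> N) (\<omega> (Suc N))"
      have single: "h (\<omega> n) (\<omega> (Suc n)) = (if n = N then c else 0)" for n
      proof (cases "tau \<omega> n \<le> t \<and> t < tau \<omega> (Suc n)")
        case True
        then have "n = N" by (intro uniq) auto
        then show ?thesis by (simp add: c_def)
      next
        case False
        then have "n \<noteq> N" and "h (\<omega> n) (\<omega> (Suc n)) = 0"
          using N SucN by (auto simp: h_def tau_def)
        then show ?thesis by simp
      qed
      have "(\<Sum>n. h (\<omega> n) (\<omega> (Suc n))) = c"
        unfolding single by (rule sums_unique[OF sums_single, symmetric])
      also have "\<dots> = f (Psi S t \<omega>)"
      proof -
        have "\<exists>n. tau \<omega> n \<le> t \<and> t < tau \<omega> (Suc n)" using N SucN by blast
        then have "Psi S t \<omega> = flow (max 0 (t - snd (snd (\<omega> N)))) (fst (\<omega> N), fst (snd (\<omega> N)))"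
          unfolding Psi_eq least Let_def by (rule if_P)
        then show ?thesis using N SucN by (simp add: c_def h_def tau_def)
      qed
      finally show "f (Psi S t \<omega>) = (\<Sum>n. h (\<omega> n) (\<omega> (Suc n)))" by simp
    qed
    from AE_tau_0[of z] AE_tau_unbounded[of t z] mono show ?thesis
      by eventually_elim (rule Psi)
  qed
  moreover have "(\<integral>\<^sup>+x. f x \<partial>Pt S p lam J t z) = (\<integral>\<^sup>+\<omega>. f (Psi S t \<omega>) \<partial>path_law z)"
    unfolding Pt_eq_distr by (rule nn_integral_distr) (simp_all add: measurable_path_law measurable_Psi)
  ultimately have "(\<integral>\<^sup>+x. f x \<partial>Pt S p lam J t z) = (\<integral>\<^sup>+\<omega>. (\<Sum>n. h (\<omega> n) (\<omega> (Suc n))) \<partial>path_law z)"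
    by (simp add: nn_integral_cong_AE)
  also have "\<dots> = (\<Sum>n. \<integral>\<^sup>+\<omega>. h (\<omega> n) (\<omega> (Suc n)) \<partial>path_law z)"
    by (rule nn_integral_suminf) measurable
  also have "\<dots> = (\<Sum>n. \<integral>\<^sup>+\<omega>. alive t f (\<omega> n) \<partial>path_law z)"
    by (simp add: nn_integral_path_law_pair transition)
  finally show ?thesis .
qed

lemma nn_integral_Pt_transition:
  assumes "0 \<le> t" "f \<in> borel_measurable borel"
  shows "(\<integral>\<^sup>+x. f x \<partial>Pt S p lam J t z) = (\<Sum>n. (transition ^^ n) (alive t f) (fst z, snd z, 0))"
  using assms by (simp add: nn_integral_Pt nn_integral_path_law)


section \<open>The renewal equation and invariant measures\<close>

text \<open>
The law of the \<open>n\<close>-th post-jump location and time if the process starts at time \<open>0\<close> from the law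
\<open>\<nu>\<close>. Working with these measures instead of \<open>\<nu>\<close>-averages of expectations makes Tonelli with respect to
them directly available.
\<close>

primrec visits :: "('y \<times> 'i) measure \<Rightarrow> nat \<Rightarrow> ('y \<times> 'i \<times> real) measure" where
  "visits \<nu> 0 = distr \<nu> Xbar (\<lambda>z. (fst z, snd z, 0))"
| "visits \<nu> (Suc n) = kernel_app (visits \<nu> n) PB"

lemma sets_visits: "sets (visits \<nu> n) = sets Xbar"
  by (induction n) auto

lemma space_visits: "space (visits \<nu> n) = space Xbar"
  using sets_visits by (rule sets_eq_imp_space_eq)

lemma measurable_visits: "visits \<nu> n \<rightarrow>\<^sub>M L = Xbar \<rightarrow>\<^sub>M L"
  using sets_visits by (rule measurable_cong_sets) simp

lemma measurable_visits_ident[measurable]: "(\<lambda>b. b) \<in> visits \<nu> n \<rightarrow>\<^sub>M borel"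
  unfolding measurable_visits by (rule measurable_Xbar_borel) measurable

lemma nn_integral_visits_0:
  assumes \<nu>: "sets \<nu> = sets borel" and g: "g \<in> borel_measurable borel"
  shows "(\<integral>\<^sup>+b. g b \<partial>visits \<nu> 0) = (\<integral>\<^sup>+z. g (fst z, snd z, 0) \<partial>\<nu>)"
  unfolding visits.simps
proof (rule nn_integral_distr)
  show "(\<lambda>z. (fst z, snd z, 0)) \<in> \<nu> \<rightarrow>\<^sub>M Xbar"
    unfolding measurable_cong_sets[OF \<nu> refl] by (rule measurable_into_Xbar) auto
qed (use g in \<open>simp add: measurable_Xbar_borel\<close>)

lemma nn_integral_visits_Suc:
  assumes g: "g \<in> borel_measurable borel"
  shows "(\<integral>\<^sup>+b. g b \<partial>visits \<nu> (Suc n)) = (\<integral>\<^sup>+b. transition g b \<partial>visits \<nu> n)"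
proof -
  have "(\<integral>\<^sup>+b. g b \<partial>visits \<nu> (Suc n)) = (\<integral>\<^sup>+b. transition (\<lambda>b. g b * indicator (space Xbar) b) b \<partial>visits \<nu> n)"
    unfolding visits.simps
    by (rule nn_integral_kernel_app_eq[OF sets_visits, where \<Phi> = "\<lambda>g. transition (\<lambda>b. g b * indicator (space Xbar) b)"])
       (auto intro!: sets_Pbar nn_integral_Pbar measurable_Xbar_borel[OF measurable_transition]
          measurable_Xbar_borel[OF g] measurable_extend_Xbar)
  also have "\<dots> = (\<integral>\<^sup>+b. transition g b \<partial>visits \<nu> n)"
    by (intro nn_integral_cong transition_cong_Xbar) (auto simp: space_visits)
  finally show ?thesis .
qed

lemma nn_integral_visits:
  assumes \<nu>: "sets \<nu> = sets borel"
  shows "g \<in> borel_measurable borel \<Longrightarrow>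
    (\<integral>\<^sup>+b. g b \<partial>visits \<nu> n) = (\<integral>\<^sup>+z. (transition ^^ n) g (fst z, snd z, 0) \<partial>\<nu>)"
proof (induction n arbitrary: g)
  case (Suc n)
  then show ?case
    using Suc.IH[OF measurable_transition[OF Suc.prems]]
    by (simp add: nn_integral_visits_Suc funpow_Suc_right del: funpow.simps visits.simps)
qed (simp add: nn_integral_visits_0[OF \<nu>] del: visits.simps)

lemma prob_space_visits:
  assumes \<nu>: "\<nu> \<in> space (prob_algebra borel)"
  shows "prob_space (visits \<nu> n)"
proof (rule prob_spaceI)
  interpret prob_space \<nu> using \<nu> by (simp add: space_prob_algebra)
  have iter: "(transition ^^ n) (\<lambda>_. 1) = (\<lambda>_. 1)"
    by (induction n) (auto simp: transition_1)
  have "(\<integral>\<^sup>+b. 1 \<partial>visits \<nu> n) = (\<integral>\<^sup>+z. (transition ^^ n) (\<lambda>_. 1) (fst z, snd z, 0) \<partial>\<nu>)"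
    using \<nu> by (intro nn_integral_visits) (auto simp: space_prob_algebra)
  then show "emeasure (visits \<nu> n) (space (visits \<nu> n)) = 1"
    by (simp add: iter emeasure_space_1)
qed

lemma nn_integral_app_Pt:
  assumes \<nu>: "sets \<nu> = sets borel" and t: "0 \<le> t" and f: "f \<in> borel_measurable borel"
  shows "(\<integral>\<^sup>+x. f x \<partial>kernel_app \<nu> (Pt S p lam J t)) = (\<integral>\<^sup>+z. \<integral>\<^sup>+x. f x \<partial>Pt S p lam J t z \<partial>\<nu>)"
proof (rule nn_integral_kernel_app_eq[OF \<nu> sets_Pt refl _ f])
  fix g :: "'y \<times> 'i \<Rightarrow> ennreal" assume g[measurable]: "g \<in> borel_measurable borel"
  have [measurable]: "(\<lambda>z. (transition ^^ n) (alive t g) (fst z, snd z, 0)) \<in> borel_measurable borel" for n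
    by (rule measurable_compose[OF _ measurable_transition_iterate]) measurable
  show "(\<lambda>z. \<integral>\<^sup>+x. g x \<partial>Pt S p lam J t z) \<in> borel_measurable borel"
    unfolding nn_integral_Pt_transition[OF t g] by measurable
qed

lemma nn_integral_app_Pt_visits:
  assumes \<nu>: "sets \<nu> = sets borel" and t: "0 \<le> t" and f[measurable]: "f \<in> borel_measurable borel"
  shows "(\<integral>\<^sup>+x. f x \<partial>kernel_app \<nu> (Pt S p lam J t)) = (\<Sum>n. \<integral>\<^sup>+b. alive t f b \<partial>visits \<nu> n)"
proof -
  have [measurable]: "(\<lambda>z. (transition ^^ n) (alive t f) (fst z, snd z, 0)) \<in> borel_measurable borel" for n
    by (rule measurable_compose[OF _ measurable_transition_iterate]) measurable
  have "(\<integral>\<^sup>+x. f x \<partial>kernel_app \<nu> (Pt S p lam J t)) =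
      (\<integral>\<^sup>+z. (\<Sum>n. (transition ^^ n) (alive t f) (fst z, snd z, 0)) \<partial>\<nu>)"
    by (simp only: nn_integral_app_Pt[OF \<nu> t f] nn_integral_Pt_transition[OF t f])
  also have "\<dots> = (\<Sum>n. \<integral>\<^sup>+z. (transition ^^ n) (alive t f) (fst z, snd z, 0) \<partial>\<nu>)"
    by (rule nn_integral_suminf) (simp add: measurable_cong_sets[OF \<nu> refl])
  also have "\<dots> = (\<Sum>n. \<integral>\<^sup>+b. alive t f b \<partial>visits \<nu> n)"
    by (simp add: nn_integral_visits[OF \<nu>])
  finally show ?thesis .
qed

lemma nn_integral_app_Wtilde:
  assumes "sets \<nu> = sets borel" "f \<in> borel_measurable borel"
  shows "(\<integral>\<^sup>+x. f x \<partial>kernel_app \<nu> (Wtilde p lam J)) = (\<integral>\<^sup>+z. jump f z \<partial>\<nu>)"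
  using assms by (intro nn_integral_kernel_app_eq[where M = borel])
    (auto simp: sets_Wtilde nn_integral_Wtilde)

lemma nn_integral_app_Gtilde:
  assumes "sets \<nu> = sets borel" "f \<in> borel_measurable borel"
  shows "(\<integral>\<^sup>+x. f x \<partial>kernel_app \<nu> (Gtilde S lam)) = (\<integral>\<^sup>+z. occupation f z \<partial>\<nu>)"
  using assms by (intro nn_integral_kernel_app_eq[where M = borel])
    (auto simp: sets_Gtilde nn_integral_Gtilde)

lemma nn_integral_app_Pker:
  assumes "sets \<nu> = sets borel" "f \<in> borel_measurable borel"
  shows "(\<integral>\<^sup>+x. f x \<partial>kernel_app \<nu> (Pker S p lam J)) = (\<integral>\<^sup>+z. occupation (jump f) z \<partial>\<nu>)"
  using assms by (intro nn_integral_kernel_app_eq[where M = borel])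
    (auto simp: sets_Pker nn_integral_Pker)

text \<open>
The substitution \<open>v = s + r\<close> from the waiting time \<open>r\<close> to the absolute time \<open>v\<close> of the next jump, where
\<open>s\<close> is the time of the current one.
\<close>

lemma transition_alive:
  assumes [measurable]: "f \<in> borel_measurable borel"
  shows "transition (alive t f) b = (\<integral>\<^sup>+v. alive v (jump (killed (t - v) f)) b \<partial>lborel)"
proof -
  define s where "s = snd (snd b)"
  define z where "z = (fst b, fst (snd b))"
  have "transition (alive t f) b = (\<integral>\<^sup>+r. killed r (jump (killed (t - (s + r)) f)) z \<partial>lborel)"
    by (simp add: transition_def alive_def s_def z_def)
  also have "\<dots> = ennreal \<bar>1\<bar> * (\<integral>\<^sup>+v. killed (- s + 1 * v) (jump (killed (t - (s + (- s + 1 * v))) f)) z \<partial>lborel)"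
    by (rule nn_integral_real_affine) auto
  also have "\<dots> = (\<integral>\<^sup>+v. alive v (jump (killed (t - v) f)) b \<partial>lborel)"
    by (simp add: alive_def s_def z_def)
  finally show ?thesis .
qed

text \<open>
The renewal equation, term by term: \<open>v\<close> is the time of the last of the \<open>n + 1\<close> jumps before \<open>t\<close>. The
inner integral has the same form as the left-hand side, with \<open>v\<close> and another function in place of \<open>t\<close>
and \<open>f\<close>, so statements for all times and functions can be proved by induction on \<open>n\<close>.
\<close>

lemma nn_integral_alive_Suc:
  assumes \<nu>: "\<nu> \<in> space (prob_algebra borel)" and [measurable]: "f \<in> borel_measurable borel"
  shows "(\<integral>\<^sup>+b. alive t f b \<partial>visits \<nu> (Suc n)) =
    (\<integral>\<^sup>+v. \<integral>\<^sup>+b. alive v (jump (killed (t - v) f)) b \<partial>visits \<nu> n \<partial>lborel)"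
proof -
  interpret visits: prob_space "visits \<nu> n" by (rule prob_space_visits[OF \<nu>])
  interpret pair_sigma_finite "visits \<nu> n" lborel ..
  have "(\<integral>\<^sup>+b. alive t f b \<partial>visits \<nu> (Suc n)) = (\<integral>\<^sup>+b. transition (alive t f) b \<partial>visits \<nu> n)"
    by (rule nn_integral_visits_Suc) measurable
  also have "\<dots> = (\<integral>\<^sup>+b. \<integral>\<^sup>+v. alive v (jump (killed (t - v) f)) b \<partial>lborel \<partial>visits \<nu> n)"
    by (simp add: transition_alive)
  also have "\<dots> = (\<integral>\<^sup>+v. \<integral>\<^sup>+b. alive v (jump (killed (t - v) f)) b \<partial>visits \<nu> n \<partial>lborel)"
    by (rule Fubini'[symmetric]) (unfold alive_def split_beta, measurable)
  finally show ?thesis .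
qed

lemma alive_neg: "b \<in> space Xbar \<Longrightarrow> v < 0 \<Longrightarrow> alive v f b = 0"
  by (simp add: alive_def killed_def space_Xbar)

lemma nn_integral_alive_0:
  assumes "sets \<nu> = sets borel" "f \<in> borel_measurable borel"
  shows "(\<integral>\<^sup>+b. alive t f b \<partial>visits \<nu> 0) = (\<integral>\<^sup>+z. killed t f z \<partial>\<nu>)"
  using assms by (simp add: nn_integral_visits_0 alive_def del: visits.simps)

lemma killed_killed: "0 \<le> t \<Longrightarrow> killed s (killed t f) z = indicator {0..} s * killed (s + t) f z"
  by (auto simp: killed_def survival_add flow_flow ennreal_mult' add.commute mult_ac split: split_indicator)

text \<open>
By the semigroup property, the first summand is the part of \<open>\<integral> Q\<^sub>u f du\<close> with \<open>u \<ge> t\<close>; the reflection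
\<open>u = t - v\<close> identifies the second one as the part with \<open>u \<le> t\<close>.
\<close>

lemma occupation_split:
  assumes t: "0 \<le> t" and [measurable]: "f \<in> borel_measurable borel"
  shows "occupation (killed t f) z + (\<integral>\<^sup>+v. indicator {0..} v * killed (t - v) f z \<partial>lborel) = occupation f z"
proof -
  have "occupation (killed t f) z = (\<integral>\<^sup>+s. indicator {0..} s * killed (s + t) f z \<partial>lborel)"
    using t by (simp add: occupation_def killed_killed)
  also have "\<dots> = ennreal \<bar>1\<bar> * (\<integral>\<^sup>+u. indicator {0..} (- t + 1 * u) * killed (- t + 1 * u + t) f z \<partial>lborel)"
    by (rule nn_integral_real_affine) auto
  also have "\<dots> = (\<integral>\<^sup>+u. indicator {t..} u * killed u f z \<partial>lborel)"
    by (auto intro!: nn_integral_cong split: split_indicator)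
  finally have 1: "occupation (killed t f) z = (\<integral>\<^sup>+u. indicator {t..} u * killed u f z \<partial>lborel)" .
  have "(\<integral>\<^sup>+v. indicator {0..} v * killed (t - v) f z \<partial>lborel) =
      ennreal \<bar>-1\<bar> * (\<integral>\<^sup>+u. indicator {0..} (t + -1 * u) * killed (t - (t + -1 * u)) f z \<partial>lborel)"
    by (rule nn_integral_real_affine) auto
  also have "\<dots> = (\<integral>\<^sup>+u. indicator {..t} u * killed u f z \<partial>lborel)"
    by (auto intro!: nn_integral_cong split: split_indicator)
  finally have 2: "(\<integral>\<^sup>+v. indicator {0..} v * killed (t - v) f z \<partial>lborel) =
      (\<integral>\<^sup>+u. indicator {..t} u * killed u f z \<partial>lborel)" .
  have "occupation (killed t f) z + (\<integral>\<^sup>+v. indicator {0..} v * killed (t - v) f z \<partial>lborel) =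
      (\<integral>\<^sup>+u. indicator {t..} u * killed u f z + indicator {..t} u * killed u f z \<partial>lborel)"
    unfolding 1 2 by (rule nn_integral_add[symmetric]) measurable
  also have "\<dots> = occupation f z"
    unfolding occupation_def
  proof (rule nn_integral_cong_AE)
    show "AE u in lborel. indicator {t..} u * killed u f z + indicator {..t} u * killed u f z = killed u f z"
      using AE_lborel_singleton[of t] by eventually_elim (auto split: split_indicator)
  qed
  finally show ?thesis .
qed

text \<open>
The constant family \<open>\<nu>\<close> solves the renewal equation whose Picard iterates sum up to \<open>\<nu> P\<^sub>t\<close>. By
induction all partial sums are at most \<open>\<nu>\<close>, and two probability measures of which one dominates the
other are equal.
\<close>

lemma invariant_if_jump_balance:
  assumes \<nu>: "\<nu> \<in> space (prob_algebra borel)" and \<kappa>: "sets \<kappa> = sets borel" "finite_measure \<kappa>"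
    and \<nu>_eq: "\<And>f. f \<in> borel_measurable borel \<Longrightarrow> (\<integral>\<^sup>+z. f z \<partial>\<nu>) = (\<integral>\<^sup>+z. occupation f z \<partial>\<kappa>)"
    and \<kappa>_eq: "\<And>f. f \<in> borel_measurable borel \<Longrightarrow> (\<integral>\<^sup>+z. f z \<partial>\<kappa>) = (\<integral>\<^sup>+z. jump f z \<partial>\<nu>)"
    and t: "0 \<le> t"
  shows "invariant_for \<nu> (Pt S p lam J t)"
proof -
  have sets: "sets \<nu> = sets borel" and prob: "prob_space \<nu>" using \<nu> by (auto simp: space_prob_algebra)
  interpret \<kappa>: finite_measure \<kappa> by fact
  interpret pair_sigma_finite \<kappa> lborel ..
  note [measurable_cong] = \<kappa>(1) sets
  have partial: "(\<Sum>n<N. \<integral>\<^sup>+b. alive t f b \<partial>visits \<nu> n) \<le> (\<integral>\<^sup>+z. f z \<partial>\<nu>)"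
    if "0 \<le> t" "f \<in> borel_measurable borel" for t f N
    using that
  proof (induction N arbitrary: t f)
    case (Suc N)
    note [measurable] = Suc.prems(2)
    let ?f = "\<lambda>v. jump (killed (t - v) f)"
    have "(\<Sum>n<Suc N. \<integral>\<^sup>+b. alive t f b \<partial>visits \<nu> n) =
        (\<integral>\<^sup>+z. killed t f z \<partial>\<nu>) + (\<Sum>n<N. \<integral>\<^sup>+v. \<integral>\<^sup>+b. alive v (?f v) b \<partial>visits \<nu> n \<partial>lborel)"
      by (simp only: sum.lessThan_Suc_shift nn_integral_alive_Suc[OF \<nu> Suc.prems(2)]
          nn_integral_alive_0[OF sets Suc.prems(2)])
    also have "(\<Sum>n<N. \<integral>\<^sup>+v. \<integral>\<^sup>+b. alive v (?f v) b \<partial>visits \<nu> n \<partial>lborel) =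
        (\<integral>\<^sup>+v. (\<Sum>n<N. \<integral>\<^sup>+b. alive v (?f v) b \<partial>visits \<nu> n) \<partial>lborel)"
    proof (rule nn_integral_sum[symmetric])
      fix n
      interpret visits: prob_space "visits \<nu> n" by (rule prob_space_visits[OF \<nu>])
      show "(\<lambda>v. \<integral>\<^sup>+b. alive v (?f v) b \<partial>visits \<nu> n) \<in> borel_measurable lborel"
        unfolding alive_def by measurable
    qed
    also have "\<dots> \<le> (\<integral>\<^sup>+v. indicator {0..} v * (\<integral>\<^sup>+z. killed (t - v) f z \<partial>\<kappa>) \<partial>lborel)"
    proof (rule nn_integral_mono)
      fix v :: real
      show "(\<Sum>n<N. \<integral>\<^sup>+b. alive v (?f v) b \<partial>visits \<nu> n) \<le> indicator {0..} v * (\<integral>\<^sup>+z. killed (t - v) f z \<partial>\<kappa>)"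
      proof (cases "0 \<le> v")
        case True
        then show ?thesis using Suc.IH[OF True, of "?f v"] by (simp add: \<kappa>_eq)
      next
        case False
        then have "(\<integral>\<^sup>+b. alive v (?f v) b \<partial>visits \<nu> n) = (\<integral>\<^sup>+b. 0 \<partial>visits \<nu> n)" for n
          by (intro nn_integral_cong) (simp add: space_visits alive_neg)
        then show ?thesis by simp
      qed
    qed
    also have "\<dots> = (\<integral>\<^sup>+v. (\<integral>\<^sup>+z. indicator {0..} v * killed (t - v) f z \<partial>\<kappa>) \<partial>lborel)"
      by (intro nn_integral_cong nn_integral_cmult[symmetric]) measurable
    also have "\<dots> = (\<integral>\<^sup>+z. (\<integral>\<^sup>+v. indicator {0..} v * killed (t - v) f z \<partial>lborel) \<partial>\<kappa>)"
      by (rule Fubini') measurable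
    also have "(\<integral>\<^sup>+z. killed t f z \<partial>\<nu>) + \<dots> =
        (\<integral>\<^sup>+z. occupation (killed t f) z + (\<integral>\<^sup>+v. indicator {0..} v * killed (t - v) f z \<partial>lborel) \<partial>\<kappa>)"
      by (subst nn_integral_add) (auto simp: \<nu>_eq)
    also have "\<dots> = (\<integral>\<^sup>+z. f z \<partial>\<nu>)"
      using Suc.prems by (simp add: occupation_split \<nu>_eq)
    finally show ?case by (simp add: add_left_mono)
  qed simp
  have le: "(\<integral>\<^sup>+x. f x \<partial>kernel_app \<nu> (Pt S p lam J t)) \<le> (\<integral>\<^sup>+z. f z \<partial>\<nu>)"
    if "f \<in> borel_measurable borel" for f
    unfolding nn_integral_app_Pt_visits[OF sets t that] suminf_eq_SUP
    by (intro SUP_least partial t that)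
  let ?N = "kernel_app \<nu> (Pt S p lam J t)"
  have em_le: "emeasure ?N A \<le> emeasure \<nu> A" if "A \<in> sets borel" for A
    using le[of "indicator A"] that sets by simp
  have space: "space \<nu> = UNIV" using sets_eq_imp_space_eq[OF sets] by simp
  have N1: "emeasure ?N UNIV = 1"
  proof -
    have "(\<integral>\<^sup>+x. 1 \<partial>?N) = (\<integral>\<^sup>+z. \<integral>\<^sup>+x. 1 \<partial>Pt S p lam J t z \<partial>\<nu>)"
      by (rule nn_integral_app_Pt[OF sets t]) measurable
    then show ?thesis
      using prob_space.emeasure_space_1[OF prob_space_Pt] prob_space.emeasure_space_1[OF prob]
      by (simp add: space)
  qed
  have "?N = \<nu>"
  proof (rule measure_eqI)
    fix A assume "A \<in> sets ?N"
    then have A: "A \<in> sets borel" "A \<in> sets \<nu>" "A \<in> sets ?N" using sets by auto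
    have "emeasure \<nu> A + emeasure \<nu> (- A) = 1"
      using A sets prob_space.emeasure_space_1[OF prob] by (subst plus_emeasure) (auto simp: space)
    also have "\<dots> = emeasure ?N A + emeasure ?N (- A)"
      using A sets N1 by (subst plus_emeasure) auto
    also have "\<dots> \<le> emeasure ?N A + emeasure \<nu> (- A)"
      using A em_le by (intro add_left_mono) auto
    finally have "emeasure \<nu> A \<le> emeasure ?N A"
      using finite_measure.emeasure_finite[OF prob_space.finite_measure[OF prob], of "- A"]
      by (simp add: add.commute[of _ "emeasure \<nu> (- A)"] ennreal_add_left_cancel_le)
    with em_le[OF A(1)] show "emeasure ?N A = emeasure \<nu> A" by simp
  qed simp
  then show ?thesis by (simp add: invariant_for_def)
qed

text \<open>
By invariance the series over the number of jumps before \<open>v\<close> sums up to \<open>\<nu>\<close> for every \<open>v\<close>, which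
turns the renewal equation into a formula for \<open>\<nu>\<close> in terms of \<open>\<kappa>\<close>. Its first term is at most
\<open>exp (- lam_min t)\<close>, and its second term increases to \<open>\<integral> occupation f d\<kappa>\<close> as \<open>t\<close> tends to infinity.
\<close>

lemma jump_balance_if_invariant:
  assumes \<nu>: "\<nu> \<in> space (prob_algebra borel)" and \<kappa>: "sets \<kappa> = sets borel" "finite_measure \<kappa>"
    and \<kappa>_eq: "\<And>f. f \<in> borel_measurable borel \<Longrightarrow> (\<integral>\<^sup>+z. f z \<partial>\<kappa>) = (\<integral>\<^sup>+z. jump f z \<partial>\<nu>)"
    and inv: "\<And>t. 0 \<le> t \<Longrightarrow> invariant_for \<nu> (Pt S p lam J t)"
  shows "\<nu> = kernel_app \<kappa> (Gtilde S lam)"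
proof -
  have sets: "sets \<nu> = sets borel" and prob: "prob_space \<nu>" using \<nu> by (auto simp: space_prob_algebra)
  interpret \<kappa>: finite_measure \<kappa> by fact
  interpret pair_sigma_finite \<kappa> lborel ..
  interpret \<nu>: prob_space \<nu> by fact
  note [measurable_cong] = \<kappa>(1) sets
  have renewal: "(\<integral>\<^sup>+z. f z \<partial>\<nu>) = (\<integral>\<^sup>+z. killed t f z \<partial>\<nu>) +
      (\<integral>\<^sup>+v. indicator {0..} v * (\<integral>\<^sup>+z. killed (t - v) f z \<partial>\<kappa>) \<partial>lborel)"
    if t: "0 \<le> t" and f[measurable]: "f \<in> borel_measurable borel" for t f
  proof -
    let ?f = "\<lambda>v. jump (killed (t - v) f)"
    have sum: "(\<Sum>n. \<integral>\<^sup>+b. alive v g b \<partial>visits \<nu> n) = (\<integral>\<^sup>+z. g z \<partial>\<nu>)"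
      if "0 \<le> v" "g \<in> borel_measurable borel" for v g
      using inv[OF that(1)] nn_integral_app_Pt_visits[OF sets that] by (simp add: invariant_for_def)
    have "(\<integral>\<^sup>+z. f z \<partial>\<nu>) = (\<Sum>n. \<integral>\<^sup>+b. alive t f b \<partial>visits \<nu> n)"
      by (simp only: sum[OF t f])
    also have "\<dots> = (\<Sum>n. \<integral>\<^sup>+b. alive t f b \<partial>visits \<nu> (n + 1)) + (\<Sum>n<1. \<integral>\<^sup>+b. alive t f b \<partial>visits \<nu> n)"
      by (rule suminf_offset) simp
    also have "\<dots> = (\<integral>\<^sup>+z. killed t f z \<partial>\<nu>) + (\<Sum>n. \<integral>\<^sup>+v. \<integral>\<^sup>+b. alive v (?f v) b \<partial>visits \<nu> n \<partial>lborel)"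
      by (simp add: nn_integral_alive_Suc[OF \<nu> f] nn_integral_alive_0[OF sets f] add.commute del: visits.simps)
    also have "(\<Sum>n. \<integral>\<^sup>+v. \<integral>\<^sup>+b. alive v (?f v) b \<partial>visits \<nu> n \<partial>lborel) =
        (\<integral>\<^sup>+v. (\<Sum>n. \<integral>\<^sup>+b. alive v (?f v) b \<partial>visits \<nu> n) \<partial>lborel)"
    proof (rule nn_integral_suminf[symmetric])
      fix n
      interpret visits: prob_space "visits \<nu> n" by (rule prob_space_visits[OF \<nu>])
      show "(\<lambda>v. \<integral>\<^sup>+b. alive v (?f v) b \<partial>visits \<nu> n) \<in> borel_measurable lborel"
        unfolding alive_def by measurable
    qed
    also have "\<dots> = (\<integral>\<^sup>+v. indicator {0..} v * (\<integral>\<^sup>+z. killed (t - v) f z \<partial>\<kappa>) \<partial>lborel)"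
    proof (rule nn_integral_cong)
      fix v :: real
      show "(\<Sum>n. \<integral>\<^sup>+b. alive v (?f v) b \<partial>visits \<nu> n) = indicator {0..} v * (\<integral>\<^sup>+z. killed (t - v) f z \<partial>\<kappa>)"
      proof (cases "0 \<le> v")
        case True
        then show ?thesis using sum[OF True, of "?f v"] by (simp add: \<kappa>_eq)
      next
        case False
        then have "(\<integral>\<^sup>+b. alive v (?f v) b \<partial>visits \<nu> n) = (\<integral>\<^sup>+b. 0 \<partial>visits \<nu> n)" for n
          by (intro nn_integral_cong) (simp add: space_visits alive_neg)
        then show ?thesis using False by simp
      qed
    qed
    finally show ?thesis .
  qed
  show ?thesis
  proof (rule measure_eqI)
    show "sets \<nu> = sets (kernel_app \<kappa> (Gtilde S lam))" by (simp add: sets \<kappa>)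
    fix A assume "A \<in> sets \<nu>"
    then have A[measurable]: "A \<in> sets borel" using sets by simp
    let ?f = "indicator A :: _ \<Rightarrow> ennreal"
    define I where "I u = (\<integral>\<^sup>+z. killed u ?f z \<partial>\<kappa>)" for u
    have [measurable]: "I \<in> borel_measurable borel" unfolding I_def[abs_def] by measurable
    have ren: "emeasure \<nu> A = (\<integral>\<^sup>+z. killed (real n) ?f z \<partial>\<nu>) + (\<integral>\<^sup>+u. indicator {..real n} u * I u \<partial>lborel)" for n
    proof -
      have "(\<integral>\<^sup>+v. indicator {0..} v * I (real n - v) \<partial>lborel) =
          ennreal \<bar>-1\<bar> * (\<integral>\<^sup>+u. indicator {0..} (real n + -1 * u) * I (real n - (real n + -1 * u)) \<partial>lborel)"
        by (rule nn_integral_real_affine) auto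
      also have "\<dots> = (\<integral>\<^sup>+u. indicator {..real n} u * I u \<partial>lborel)"
        by (auto intro!: nn_integral_cong split: split_indicator)
      finally show ?thesis
        using renewal[of "real n" ?f] A sets by (simp add: I_def[symmetric])
    qed
    have "(\<lambda>n. \<integral>\<^sup>+z. killed (real n) ?f z \<partial>\<nu>) \<longlonglongrightarrow> 0"
    proof (rule tendsto_sandwich[OF _ _ tendsto_const])
      show "eventually (\<lambda>n. (\<integral>\<^sup>+z. killed (real n) ?f z \<partial>\<nu>) \<le> ennreal (exp (- lam_min * real n))) sequentially"
      proof (rule always_eventually, rule allI)
        fix n
        have "killed (real n) ?f z \<le> ennreal (exp (- lam_min * real n))" for z
          using survival_bounds(2)[of "real n" z]
          by (auto simp: killed_def ennreal_leI split: split_indicator)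
        then have "(\<integral>\<^sup>+z. killed (real n) ?f z \<partial>\<nu>) \<le> (\<integral>\<^sup>+z. ennreal (exp (- lam_min * real n)) \<partial>\<nu>)"
          by (intro nn_integral_mono)
        then show "(\<integral>\<^sup>+z. killed (real n) ?f z \<partial>\<nu>) \<le> ennreal (exp (- lam_min * real n))"
          by (simp add: \<nu>.emeasure_space_1)
      qed
      have "(\<lambda>n. ennreal (exp (- lam_min) ^ n)) \<longlonglongrightarrow> ennreal 0"
        using lam_bounds(1) by (intro tendsto_ennrealI LIMSEQ_realpow_zero) auto
      moreover have "exp (- lam_min) ^ n = exp (- lam_min * real n)" for n
        by (simp only: exp_of_nat_mult[symmetric] mult.commute)
      ultimately show "(\<lambda>n. ennreal (exp (- lam_min * real n))) \<longlonglongrightarrow> 0"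
        by simp
    qed simp
    moreover have "(\<lambda>n. \<integral>\<^sup>+u. indicator {..real n} u * I u \<partial>lborel) \<longlonglongrightarrow> (\<integral>\<^sup>+u. I u \<partial>lborel)"
    proof (rule nn_integral_LIMSEQ)
      show "incseq (\<lambda>n u. indicator {..real n} u * I u)"
        by (auto simp: incseq_def le_fun_def split: split_indicator)
      show "(\<lambda>n. indicator {..real n} u * I u) \<longlonglongrightarrow> I u" for u
      proof (rule tendsto_eventually)
        obtain N where "u \<le> real N" using real_arch_simple by blast
        then show "eventually (\<lambda>n. indicator {..real n} u * I u = I u) sequentially"
          by (intro eventually_sequentiallyI[of N]) (auto split: split_indicator)
      qed
    qed measurable
    ultimately have "(\<lambda>n. (\<integral>\<^sup>+z. killed (real n) ?f z \<partial>\<nu>) +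
        (\<integral>\<^sup>+u. indicator {..real n} u * I u \<partial>lborel)) \<longlonglongrightarrow> 0 + (\<integral>\<^sup>+u. I u \<partial>lborel)"
      by (rule tendsto_add)
    then have "(\<lambda>n. emeasure \<nu> A) \<longlonglongrightarrow> 0 + (\<integral>\<^sup>+u. I u \<partial>lborel)"
      by (simp only: ren[symmetric])
    then have "emeasure \<nu> A = (\<integral>\<^sup>+u. I u \<partial>lborel)"
      using LIMSEQ_unique[OF tendsto_const] by fastforce
    also have "\<dots> = (\<integral>\<^sup>+z. occupation ?f z \<partial>\<kappa>)"
      unfolding I_def occupation_def by (rule Fubini') measurable
    also have "\<dots> = emeasure (kernel_app \<kappa> (Gtilde S lam)) A"
      using nn_integral_app_Gtilde[OF \<kappa>(1), of ?f] A \<kappa>(1) by simp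
    finally show "emeasure \<nu> A = emeasure (kernel_app \<kappa> (Gtilde S lam)) A" .
  qed
qed

lemma occupation_1_bounds: "ennreal (1 / lam_max) \<le> occupation (\<lambda>_. 1) z" "occupation (\<lambda>_. 1) z \<le> ennreal (1 / lam_min)"
proof -
  have "(\<integral>\<^sup>+r. ennreal (exp (- (lam_max * r))) * indicator {0..} r \<partial>lborel) \<le> occupation (\<lambda>_. 1) z"
    unfolding occupation_def using survival_bounds(1)[of _ z]
    by (intro nn_integral_mono) (auto simp: killed_def ennreal_leI split: split_indicator)
  then show "ennreal (1 / lam_max) \<le> occupation (\<lambda>_. 1) z"
    by (simp only: nn_integral_exp_decay[OF lam_bounds(2)])
  have "occupation (\<lambda>_. 1) z \<le> (\<integral>\<^sup>+r. ennreal (exp (- (lam_min * r))) * indicator {0..} r \<partial>lborel)"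
    unfolding occupation_def using survival_bounds(2)[of _ z]
    by (intro nn_integral_mono) (auto simp: killed_def ennreal_leI split: split_indicator)
  then show "occupation (\<lambda>_. 1) z \<le> ennreal (1 / lam_min)"
    by (simp only: nn_integral_exp_decay[OF lam_bounds(1)])
qed

lemma mass_app_Gtilde:
  assumes \<mu>: "\<mu> \<in> space (prob_algebra borel)"
  defines "m \<equiv> emeasure (kernel_app \<mu> (Gtilde S lam)) (space (kernel_app \<mu> (Gtilde S lam)))"
  shows "0 < m" "m < \<infinity>"
proof -
  interpret prob_space \<mu> using \<mu> by (simp add: space_prob_algebra)
  have m: "m = (\<integral>\<^sup>+z. occupation (\<lambda>_. 1) z \<partial>\<mu>)"
    unfolding m_def emeasure_space_nn_integral using \<mu>
    by (intro nn_integral_app_Gtilde) (auto simp: space_prob_algebra)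
  have "(\<integral>\<^sup>+z. ennreal (1 / lam_max) \<partial>\<mu>) \<le> m"
    unfolding m by (intro nn_integral_mono occupation_1_bounds)
  then show "0 < m" using lam_bounds(2) by (simp add: emeasure_space_1 less_le_trans[rotated])
  have "m \<le> (\<integral>\<^sup>+z. ennreal (1 / lam_min) \<partial>\<mu>)"
    unfolding m by (intro nn_integral_mono occupation_1_bounds)
  then show "m < \<infinity>" by (simp add: emeasure_space_1 le_less_trans)
qed

lemma mass_app_Wtilde:
  assumes \<nu>: "\<nu> \<in> space (prob_algebra borel)"
  defines "m \<equiv> emeasure (kernel_app \<nu> (Wtilde p lam J)) (space (kernel_app \<nu> (Wtilde p lam J)))"
  shows "0 < m" "m < \<infinity>"
proof -
  interpret prob_space \<nu> using \<nu> by (simp add: space_prob_algebra)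
  have m: "m = (\<integral>\<^sup>+z. ennreal (lam (fst z)) \<partial>\<nu>)"
  proof -
    have "m = (\<integral>\<^sup>+z. jump (\<lambda>_. 1) z \<partial>\<nu>)"
      unfolding m_def emeasure_space_nn_integral using \<nu>
      by (intro nn_integral_app_Wtilde) (auto simp: space_prob_algebra)
    also have "\<dots> = (\<integral>\<^sup>+z. ennreal (lam (fst z)) \<partial>\<nu>)"
      by (intro nn_integral_cong) (simp add: jump_const)
    finally show ?thesis .
  qed
  have "(\<integral>\<^sup>+z. ennreal lam_min \<partial>\<nu>) \<le> m"
    unfolding m using lam_bounds(3) by (intro nn_integral_mono ennreal_leI) auto
  then show "0 < m" using lam_bounds(1) by (simp add: emeasure_space_1 less_le_trans[rotated])
  have "m \<le> (\<integral>\<^sup>+z. ennreal lam_max \<partial>\<nu>)"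
    unfolding m using lam_bounds(3) by (intro nn_integral_mono ennreal_leI) auto
  then show "m < \<infinity>" by (simp add: emeasure_space_1 le_less_trans)
qed

lemma kernel_app_Wtilde_scale:
  "sets \<nu> = sets borel \<Longrightarrow>
    kernel_app (scale_measure c \<nu>) (Wtilde p lam J) = scale_measure c (kernel_app \<nu> (Wtilde p lam J))"
  by (rule kernel_app_scale[where M = borel and \<Phi> = jump]) (auto simp: sets_Wtilde nn_integral_Wtilde)

lemma kernel_app_Gtilde_scale:
  "sets \<nu> = sets borel \<Longrightarrow>
    kernel_app (scale_measure c \<nu>) (Gtilde S lam) = scale_measure c (kernel_app \<nu> (Gtilde S lam))"
  by (rule kernel_app_scale[where M = borel and \<Phi> = occupation]) (auto simp: sets_Gtilde nn_integral_Gtilde)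

lemma kernel_app_Pker:
  assumes "sets \<mu> = sets borel"
  shows "kernel_app \<mu> (Pker S p lam J) = kernel_app (kernel_app \<mu> (Gtilde S lam)) (Wtilde p lam J)"
proof (rule measure_eqI_nn_integral)
  fix f :: "'y \<times> 'i \<Rightarrow> ennreal" assume "f \<in> borel_measurable (kernel_app \<mu> (Pker S p lam J))"
  then have [measurable]: "f \<in> borel_measurable borel"
    using measurable_cong_sets[OF assms refl, of "borel :: ennreal measure"] by (simp cong: measurable_cong_sets)
  show "(\<integral>\<^sup>+x. f x \<partial>kernel_app \<mu> (Pker S p lam J)) =
     (\<integral>\<^sup>+x. f x \<partial>kernel_app (kernel_app \<mu> (Gtilde S lam)) (Wtilde p lam J))"
    using assms by (simp add: nn_integral_app_Wtilde nn_integral_app_Gtilde nn_integral_app_Pker)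
qed simp

text \<open>
The mass leaving through jumps, redistributed by the jump kernel and carried along by the killed flow,
must reproduce \<open>\<nu>\<close>. This equation does not mention time any more, and it is what links the semigroup to
the chain with kernel \<open>G W\<close>.
\<close>

theorem invariant_Pt_iff:
  assumes \<nu>: "\<nu> \<in> space (prob_algebra borel)"
  shows "(\<forall>t\<ge>0. invariant_for \<nu> (Pt S p lam J t)) \<longleftrightarrow>
    kernel_app (kernel_app \<nu> (Wtilde p lam J)) (Gtilde S lam) = \<nu>"
proof -
  let ?\<kappa> = "kernel_app \<nu> (Wtilde p lam J)"
  have sets: "sets \<nu> = sets borel" using \<nu> by (simp add: space_prob_algebra)
  have \<kappa>: "sets ?\<kappa> = sets borel" by (simp add: sets)
  have fin: "finite_measure ?\<kappa>"
    using mass_app_Wtilde(2)[OF \<nu>] by (intro finite_measureI) auto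
  have \<kappa>_eq: "(\<integral>\<^sup>+z. f z \<partial>?\<kappa>) = (\<integral>\<^sup>+z. jump f z \<partial>\<nu>)" if "f \<in> borel_measurable borel" for f
    using sets that by (rule nn_integral_app_Wtilde)
  show ?thesis
  proof
    assume "\<forall>t\<ge>0. invariant_for \<nu> (Pt S p lam J t)"
    then show "kernel_app ?\<kappa> (Gtilde S lam) = \<nu>"
      by (intro jump_balance_if_invariant[OF \<nu> \<kappa> fin \<kappa>_eq, symmetric]) auto
  next
    assume eq: "kernel_app ?\<kappa> (Gtilde S lam) = \<nu>"
    show "\<forall>t\<ge>0. invariant_for \<nu> (Pt S p lam J t)"
    proof (intro allI impI invariant_if_jump_balance[OF \<nu> \<kappa> fin _ \<kappa>_eq])
      show "(\<integral>\<^sup>+z. f z \<partial>\<nu>) = (\<integral>\<^sup>+z. occupation f z \<partial>?\<kappa>)" if "f \<in> borel_measurable borel" for f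
        using nn_integral_app_Gtilde[OF \<kappa> that] by (simp add: eq)
    qed
  qed
qed

lemma invariant_Pt_of_invariant_Pker:
  assumes \<mu>: "\<mu> \<in> space (prob_algebra borel)" and inv: "invariant_for \<mu> (Pker S p lam J)"
  defines "\<nu> \<equiv> normalized (kernel_app \<mu> (Gtilde S lam))"
  shows "\<nu> \<in> space (prob_algebra borel)"
    and "\<forall>t\<ge>0. invariant_for \<nu> (Pt S p lam J t)"
    and "\<mu> = normalized (kernel_app \<nu> (Wtilde p lam J))"
proof -
  let ?\<mu>G = "kernel_app \<mu> (Gtilde S lam)"
  define c where "c = 1 / emeasure ?\<mu>G (space ?\<mu>G)"
  have sets: "sets \<mu> = sets borel" and prob: "prob_space \<mu>" using \<mu> by (auto simp: space_prob_algebra)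
  have c: "0 < c" "c < \<infinity>"
    using mass_app_Gtilde[OF \<mu>] by (auto simp: c_def ennreal_zero_less_divide ennreal_divide_eq_top_iff less_top[symmetric])
  have \<nu>: "\<nu> = scale_measure c ?\<mu>G" by (simp add: \<nu>_def normalized_def c_def)
  show prob_\<nu>: "\<nu> \<in> space (prob_algebra borel)"
    unfolding \<nu>_def using mass_app_Gtilde[OF \<mu>] by (intro normalized_in_prob_algebra) (auto simp: sets)
  have "kernel_app ?\<mu>G (Wtilde p lam J) = \<mu>"
    using inv by (simp add: invariant_for_def kernel_app_Pker[OF sets])
  then have \<nu>W: "kernel_app \<nu> (Wtilde p lam J) = scale_measure c \<mu>"
    by (simp add: \<nu> kernel_app_Wtilde_scale sets)
  show "\<forall>t\<ge>0. invariant_for \<nu> (Pt S p lam J t)"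
    unfolding invariant_Pt_iff[OF prob_\<nu>] \<nu>W by (simp add: kernel_app_Gtilde_scale sets \<nu>)
  show "\<mu> = normalized (kernel_app \<nu> (Wtilde p lam J))"
    unfolding \<nu>W using normalized_scale_prob_space[OF prob c] by simp
qed

lemma invariant_Pker_of_invariant_Pt:
  assumes \<nu>: "\<nu> \<in> space (prob_algebra borel)" and inv: "\<forall>t\<ge>0. invariant_for \<nu> (Pt S p lam J t)"
  defines "\<mu> \<equiv> normalized (kernel_app \<nu> (Wtilde p lam J))"
  shows "\<mu> \<in> space (prob_algebra borel)"
    and "invariant_for \<mu> (Pker S p lam J)"
    and "\<nu> = normalized (kernel_app \<mu> (Gtilde S lam))"
proof -
  let ?\<nu>W = "kernel_app \<nu> (Wtilde p lam J)"
  define c where "c = 1 / emeasure ?\<nu>W (space ?\<nu>W)"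
  have sets: "sets \<nu> = sets borel" and prob: "prob_space \<nu>" using \<nu> by (auto simp: space_prob_algebra)
  have c: "0 < c" "c < \<infinity>"
    using mass_app_Wtilde[OF \<nu>] by (auto simp: c_def ennreal_zero_less_divide ennreal_divide_eq_top_iff less_top[symmetric])
  have \<mu>: "\<mu> = scale_measure c ?\<nu>W" by (simp add: \<mu>_def normalized_def c_def)
  show "\<mu> \<in> space (prob_algebra borel)"
    unfolding \<mu>_def using mass_app_Wtilde[OF \<nu>] by (intro normalized_in_prob_algebra) (auto simp: sets)
  have \<mu>G: "kernel_app \<mu> (Gtilde S lam) = scale_measure c \<nu>"
  proof -
    have "kernel_app ?\<nu>W (Gtilde S lam) = \<nu>"
      using inv by (simp only: invariant_Pt_iff[OF \<nu>])
    then show ?thesis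
      unfolding \<mu> by (subst kernel_app_Gtilde_scale) (simp_all add: sets)
  qed
  show "invariant_for \<mu> (Pker S p lam J)"
  proof -
    have "kernel_app \<mu> (Pker S p lam J) = kernel_app (kernel_app \<mu> (Gtilde S lam)) (Wtilde p lam J)"
      by (rule kernel_app_Pker) (simp add: \<mu> sets)
    also have "\<dots> = \<mu>"
      unfolding \<mu>G kernel_app_Wtilde_scale[OF sets] by (rule \<mu>[symmetric])
    finally show ?thesis by (simp only: invariant_for_def)
  qed
  show "\<nu> = normalized (kernel_app \<mu> (Gtilde S lam))"
    unfolding \<mu>G using normalized_scale_prob_space[OF prob c] by simp
qed

end


section \<open>The correspondence of invariant measures\<close>

theorem theorem4p5:
  fixes S :: "'i::finite_discrete \<Rightarrow> real \<Rightarrow> 'y::polish_space \<Rightarrow> 'y"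
    and p :: "'i \<Rightarrow> 'i \<Rightarrow> 'y \<Rightarrow> real"
    and lam :: "'y \<Rightarrow> real"
    and J :: "'y \<Rightarrow> 'y measure"
    and lam_min lam_max :: real
  assumes S: "\<And>i. semiflow (S i)"
    and p_cont: "\<And>i j. continuous_on UNIV (p i j)"
    and p_range: "\<And>i j y. 0 \<le> p i j y \<and> p i j y \<le> 1"
    and p_sum: "\<And>i y. (\<Sum>j\<in>UNIV. p i j y) = 1"
    and lam_cont: "continuous_on UNIV lam"
    and lam_bounds: "0 < lam_min" "0 < lam_max" "\<And>y. lam_min \<le> lam y \<and> lam y \<le> lam_max"
    and J: "J \<in> borel \<rightarrow>\<^sub>M prob_algebra borel"
    and J_cont: "\<And>g :: 'y \<times> real \<Rightarrow> real.
        continuous_on (UNIV \<times> {0..}) g \<Longrightarrow> bounded (g ` (UNIV \<times> {0..})) \<Longrightarrow>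
        continuous_on (UNIV \<times> {0..}) (\<lambda>(y, t). \<integral>u. g (u, t) \<partial>J y)"
  shows
    "(\<forall>\<mu>\<Phi> :: ('y \<times> 'i) measure.
        \<mu>\<Phi> \<in> space (prob_algebra borel) \<and> invariant_for \<mu>\<Phi> (Pker S p lam J) \<longrightarrow>
        (let \<mu>\<Psi> = normalized (kernel_app \<mu>\<Phi> (Gtilde S lam)) in
           \<mu>\<Psi> \<in> space (prob_algebra borel) \<and>
           (\<forall>t\<ge>0. invariant_for \<mu>\<Psi> (Pt S p lam J t)) \<and>
           \<mu>\<Phi> = normalized (kernel_app \<mu>\<Psi> (Wtilde p lam J))))
     \<and>
     (\<forall>\<mu>\<Psi> :: ('y \<times> 'i) measure.
        \<mu>\<Psi> \<in> space (prob_algebra borel) \<and> (\<forall>t\<ge>0. invariant_for \<mu>\<Psi> (Pt S p lam J t)) \<longrightarrow>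
        (let \<mu>\<Phi> = normalized (kernel_app \<mu>\<Psi> (Wtilde p lam J)) in
           \<mu>\<Phi> \<in> space (prob_algebra borel) \<and>
           invariant_for \<mu>\<Phi> (Pker S p lam J) \<and>
           \<mu>\<Psi> = normalized (kernel_app \<mu>\<Phi> (Gtilde S lam))))"
proof -
  interpret switched_flow S p lam J lam_min lam_max
    by (rule switched_flow.intro) (fact S p_cont p_range p_sum lam_cont lam_bounds J)+
  show ?thesis
    unfolding Let_def
  proof (intro conjI allI impI; elim conjE)
    fix \<mu>\<Phi> :: "('y \<times> 'i) measure"
    assume "\<mu>\<Phi> \<in> space (prob_algebra borel)" "invariant_for \<mu>\<Phi> (Pker S p lam J)"
    note * = invariant_Pt_of_invariant_Pker[OF this]
    show "normalized (kernel_app \<mu>\<Phi> (Gtilde S lam)) \<in> space (prob_algebra borel)" by (rule *(1))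
    show "\<mu>\<Phi> = normalized (kernel_app (normalized (kernel_app \<mu>\<Phi> (Gtilde S lam))) (Wtilde p lam J))"
      by (rule *(3))
    fix t :: real assume "0 \<le> t"
    then show "invariant_for (normalized (kernel_app \<mu>\<Phi> (Gtilde S lam))) (Pt S p lam J t)"
      using *(2) by blast
  next
    fix \<mu>\<Psi> :: "('y \<times> 'i) measure"
    assume "\<mu>\<Psi> \<in> space (prob_algebra borel)" "\<forall>t\<ge>0. invariant_for \<mu>\<Psi> (Pt S p lam J t)"
    note * = invariant_Pker_of_invariant_Pt[OF this]
    show "normalized (kernel_app \<mu>\<Psi> (Wtilde p lam J)) \<in> space (prob_algebra borel)" by (rule *(1))
    show "invariant_for (normalized (kernel_app \<mu>\<Psi> (Wtilde p lam J))) (Pker S p lam J)" by (rule *(2))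
    show "\<mu>\<Psi> = normalized (kernel_app (normalized (kernel_app \<mu>\<Psi> (Wtilde p lam J))) (Gtilde S lam))"
      by (rule *(3))
  qed
qed

end
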